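(* Let $F_t$ be a semi-linear, but not linear, one-parameter affine family on $\mathbb{R}^d$. There is a number $\tau\in(0,t_0]$ such that the attractor $A_t$ of $F_t$ is weakly connected for $t\in(\tau,t_0)$ and strongly disconnected for $t\in(0,\tau)$. Moreover, $\tau<t_0$ if the functions in $F_t$ are similarities.
   Context: A function $f:\mathbb{R}^d\to\mathbb{R}^d$ is affine if $f(x)=Lx+a$, where $L$ is a non-singular $d\times d$ real matrix (the linear part of $f$) and $a\in\mathbb{R}^d$. A one-parameter affine family is given by $N\ge 2$ affine functions $F=\{f_1,\dots,f_N\}$ on $\mathbb{R}^d$ and vectors $q_1,\dots,q_N\in\mathbb{R}^d$; for each real $t\ge 0$ it is $F_t=\{f_{(i,t)} : 1\le i\le N\}$ with $f_{(i,t)}(x)=t f_i(x)+q_i$. The Hutchinson operator of $F_t$ on non-empty compact sets is $F_t(K)=\bigcup_{f\in F_t} f(K)$. A non-empty compact set $A_t$ is the attractor of $F_t$ if $A_t=\lim_{k\to\infty}F_t^k(K)$ in the Hausdorff metric for every non-empty compact $K$. If $L_1,\dots,L_N$ are the linear parts of $f_1,\dots,f_N$, the joint spectral radius of $F$ is $\rho(F)=\limsup_{k\to\infty}\big(\max\|L_{i_1}\cdots L_{i_k}\|\big)^{1/k}$, the maximum being over all words of length $k$ in $\{1,\dots,N\}$. Set $t_0=1/\rho(F)$; the attractor $A_t$ exists exactly for $t\in[0,t_0)$. Functions $f,g$ on $\mathbb{R}^d$ are conjugate by a function $h$ if $g=h^{-1}fh$. The family $F_t$ is linear if, for all $i$ and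 all $t\in[0,t_0)$, $f_{(i,t)}$ is conjugate to a linear function by a function $h$ independent of $i$ and $t$; it is semi-linear if, for all $i$ and all $t\in[0,t_0)$, $f_{(i,t)}$ is conjugate to a linear function by a function $h_i$ independent of $t$. An (affine) hyperplane $H$ in $\mathbb{R}^d$ separates a compact set $S$ if $S\cap H=\emptyset$ but $S$ has non-empty intersection with both half-spaces determined by $H$. A compact set $S\subset\mathbb{R}^d$ is strongly disconnected if there exists a hyperplane that separates $S$, and weakly connected if there is no such hyperplane. *)

theory Defs
  imports "HOL-Analysis.Analysis"
begin

definition affine_function :: "(real^'n \<Rightarrow> real^'n) \<Rightarrow> bool" where
  "affine_function f \<longleftrightarrow>
     (\<exists>(L :: real^'n^'n) a. invertible L \<and> (\<forall>x. f x = L *v x + a))"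

definition linear_part :: "(real^'n \<Rightarrow> real^'n) \<Rightarrow> real^'n^'n" where
  "linear_part f = (THE L. \<exists>a. \<forall>x. f x = L *v x + a)"

text \<open>The functions \<open>f\<^sub>1, \<dots>, f\<^sub>N\<close> and vectors \<open>q\<^sub>1, \<dots>, q\<^sub>N\<close> are given by functions on
  \<open>nat\<close>, of which only the values at indices in \<open>{1..N}\<close> are ever used.\<close>

definition affine_family :: "nat \<Rightarrow> (nat \<Rightarrow> real^'n \<Rightarrow> real^'n) \<Rightarrow> bool" where
  "affine_family N f \<longleftrightarrow> N \<ge> 2 \<and> (\<forall>i\<in>{1..N}. affine_function (f i))"

definition family_fun ::
    "(nat \<Rightarrow> real^'n \<Rightarrow> real^'n) \<Rightarrow> (nat \<Rightarrow> real^'n) \<Rightarrow> nat \<Rightarrow> real \<Rightarrow> real^'n \<Rightarrow> real^'n" where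
  "family_fun f q i t = (\<lambda>x. t *\<^sub>R f i x + q i)"

definition hutchinson :: "nat \<Rightarrow> (nat \<Rightarrow> 'a \<Rightarrow> 'a) \<Rightarrow> 'a set \<Rightarrow> 'a set" where
  "hutchinson N g K = (\<Union>i\<in>{1..N}. g i ` K)"

text \<open>The Hausdorff distance; it is only used for non-empty compact sets, where both suprema
  are over non-empty bounded sets.\<close>

definition hausdorff_distance :: "'a::metric_space set \<Rightarrow> 'a set \<Rightarrow> real" where
  "hausdorff_distance S T = max (SUP x\<in>S. infdist x T) (SUP y\<in>T. infdist y S)"

definition is_attractor :: "nat \<Rightarrow> (nat \<Rightarrow> 'a \<Rightarrow> 'a) \<Rightarrow> 'a::metric_space set \<Rightarrow> bool" where
  "is_attractor N g A \<longleftrightarrow> A \<noteq> {} \<and> compact A \<and>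
     (\<forall>K. K \<noteq> {} \<and> compact K \<longrightarrow>
        (\<lambda>k. hausdorff_distance ((hutchinson N g ^^ k) K) A) \<longlonglongrightarrow> 0)"

text \<open>The description below is only meaningful when an attractor exists, which is the case exactly
  for \<open>0 \<le> t < t0 N f\<close>; it is then unique as a Hausdorff limit.\<close>

definition attractor ::
    "nat \<Rightarrow> (nat \<Rightarrow> real^'n \<Rightarrow> real^'n) \<Rightarrow> (nat \<Rightarrow> real^'n) \<Rightarrow> real \<Rightarrow> (real^'n) set" where
  "attractor N f q t = (THE A. is_attractor N (\<lambda>i. family_fun f q i t) A)"

definition word_matrix :: "(nat \<Rightarrow> real^'n^'n) \<Rightarrow> nat list \<Rightarrow> real^'n^'n" where
  "word_matrix L w = foldr (\<lambda>i M. L i ** M) w (mat 1)"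

text \<open>The matrix norm is the Euclidean operator norm. The sequence under the limit superior is
  bounded, so nothing is lost by converting back from the extended reals.\<close>

definition joint_spectral_radius :: "nat \<Rightarrow> (nat \<Rightarrow> real^'n \<Rightarrow> real^'n) \<Rightarrow> real" where
  "joint_spectral_radius N f = real_of_ereal (limsup (\<lambda>k. ereal (root k
     (MAX w\<in>{w. length w = k \<and> set w \<subseteq> {1..N}}.
        onorm ((*v) (word_matrix (\<lambda>i. linear_part (f i)) w))))))"

definition t0 :: "nat \<Rightarrow> (nat \<Rightarrow> real^'n \<Rightarrow> real^'n) \<Rightarrow> real" where
  "t0 N f = 1 / joint_spectral_radius N f"

definition conjugate_by :: "('a \<Rightarrow> 'a) \<Rightarrow> ('a \<Rightarrow> 'a) \<Rightarrow> ('a \<Rightarrow> 'a) \<Rightarrow> bool" where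
  "conjugate_by h f g \<longleftrightarrow> bij h \<and> g = inv h \<circ> f \<circ> h"

definition linear_family ::
    "nat \<Rightarrow> (nat \<Rightarrow> real^'n \<Rightarrow> real^'n) \<Rightarrow> (nat \<Rightarrow> real^'n) \<Rightarrow> bool" where
  "linear_family N f q \<longleftrightarrow>
     (\<exists>h. \<forall>i\<in>{1..N}. \<forall>t\<in>{0..<t0 N f}. \<exists>g. linear g \<and> conjugate_by h (family_fun f q i t) g)"

definition semilinear_family ::
    "nat \<Rightarrow> (nat \<Rightarrow> real^'n \<Rightarrow> real^'n) \<Rightarrow> (nat \<Rightarrow> real^'n) \<Rightarrow> bool" where
  "semilinear_family N f q \<longleftrightarrow>
     (\<forall>i\<in>{1..N}. \<exists>h. \<forall>t\<in>{0..<t0 N f}. \<exists>g. linear g \<and> conjugate_by h (family_fun f q i t) g)"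

text \<open>The hyperplane \<open>{x. c \<bullet> x = b}\<close>, for \<open>c \<noteq> 0\<close>, separates \<open>S\<close>.\<close>

definition hyperplane_separates :: "'a::euclidean_space \<Rightarrow> real \<Rightarrow> 'a set \<Rightarrow> bool" where
  "hyperplane_separates c b S \<longleftrightarrow>
     S \<inter> {x. c \<bullet> x = b} = {} \<and> S \<inter> {x. c \<bullet> x < b} \<noteq> {} \<and> S \<inter> {x. c \<bullet> x > b} \<noteq> {}"

definition strongly_disconnected :: "'a::euclidean_space set \<Rightarrow> bool" where
  "strongly_disconnected S \<longleftrightarrow> (\<exists>c b. c \<noteq> 0 \<and> hyperplane_separates c b S)"

definition weakly_connected :: "'a::euclidean_space set \<Rightarrow> bool" where
  "weakly_connected S \<longleftrightarrow> \<not> (\<exists>c b. c \<noteq> 0 \<and> hyperplane_separates c b S)"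

definition is_similarity :: "('a::metric_space \<Rightarrow> 'a) \<Rightarrow> bool" where
  "is_similarity g \<longleftrightarrow> (\<exists>r>0. \<forall>x y. dist (g x) (g y) = r * dist x y)"

end

theory Submission
  imports Defs
begin

text \<open>A semi-linear family has the form \<open>f\<^bsub>(i,t)\<^esub>(x) = q\<^sub>i + t L\<^sub>i (x - q\<^sub>i)\<close>: the conjugating bijection \<open>h\<^sub>i\<close> sends \<open>0\<close>
to a fixed point of all the maps \<open>f\<^bsub>(i,t)\<^esub>\<close>, and \<open>t = 0\<close> shows that this point is \<open>q\<^sub>i\<close>. The family fails to
be linear only if the centres \<open>q\<^sub>i\<close> are not all equal.

Let \<open>K\<^sub>t\<close> be the convex hull of the attractor \<open>A\<^sub>t\<close>. Weak connectivity says that every functional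
\<open>x \<mapsto> c \<bullet> x\<close> maps \<open>A\<^sub>t\<close> onto an interval, which is then its image of \<open>K\<^sub>t\<close>. The main point is that
this can be read off after one step of the iteration: \<open>A\<^sub>t\<close> is weakly connected iff for every \<open>c\<close> the
intervals \<open>J\<^sub>i(t) = c \<bullet> f\<^bsub>(i,t)\<^esub>(K\<^sub>t)\<close> cover \<open>c \<bullet> K\<^sub>t\<close>. Indeed, \<open>c \<bullet> f\<^bsub>(i,t)\<^esub>\<close> is again a functional up
to a constant, so the covering property passes to all iterates of \<open>K\<^sub>t\<close> and, in the limit, to \<open>A\<^sub>t\<close>.
Each \<open>J\<^sub>i(t)\<close> contains \<open>c \<bullet> q\<^sub>i\<close>, and the end points of \<open>c \<bullet> K\<^sub>t\<close> are always covered; hence only the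
values between the \<open>c \<bullet> q\<^sub>i\<close> can be missed (\<open>weakly_connected_if_covered_between\<close>).

Monotonicity (\<open>weakly_connected_mono\<close>): \<open>f\<^bsub>(i,s)\<^esub>(x)\<close> lies between \<open>q\<^sub>i\<close> and \<open>f\<^bsub>(i,t)\<^esub>(x)\<close> for
\<open>s \<le> t\<close>, so \<open>K\<^sub>s \<subseteq> K\<^sub>t\<close> and \<open>J\<^sub>i(s) \<subseteq> J\<^sub>i(t)\<close>. If \<open>A\<^sub>s\<close> is weakly connected, then all values between
the \<open>c \<bullet> q\<^sub>i\<close> are covered at \<open>s\<close>, therefore also at \<open>t\<close>. So the weakly connected parameters form a
final segment of \<open>(0, t\<^sub>0)\<close>, and \<open>\<tau>\<close> is its infimum (or \<open>t\<^sub>0\<close>, if there are none). For small \<open>t\<close> the pieces of \<open>A\<^sub>t\<close> are concentrated near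
the centres, which a hyperplane separates (\<open>strongly_disconnected_small\<close>); hence \<open>\<tau> > 0\<close>.

Similarities (\<open>weakly_connected_similarities\<close>): let \<open>k\<close> be the index with the largest ratio \<open>r\<close>. As
\<open>t \<rightarrow> 1 / r\<close>, the map \<open>f\<^bsub>(k,t)\<^esub>\<close> approaches an isometry \<open>E\<close> around \<open>q\<^sub>k\<close>, some power of which is close to
the identity. So \<open>f\<^bsub>(k,t)\<^esub>(K\<^sub>t)\<close> almost contains the attractor \<open>A\<^sub>s\<close> of a fixed smaller parameter
\<open>s\<close>. All pieces of \<open>A\<^sub>s\<close> have a width that is bounded below in every relevant direction, so each
\<open>J\<^sub>l(t)\<close> meets \<open>J\<^sub>k(t)\<close>, and no value between the centres is missed. Finally
\<open>1 / r \<le> t\<^sub>0\<close>, because the joint spectral radius is at most the largest norm of the \<open>L\<^sub>i\<close>.\<close>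

section \<open>Attractors of eventually contractive families\<close>

definition words :: "nat \<Rightarrow> nat \<Rightarrow> nat list set" where
  "words N k = {w. length w = k \<and> set w \<subseteq> {1..N}}"

definition word_map :: "(nat \<Rightarrow> 'a \<Rightarrow> 'a) \<Rightarrow> nat list \<Rightarrow> 'a \<Rightarrow> 'a" where
  "word_map g w = foldr (\<lambda>i h. g i \<circ> h) w id"

lemma word_map_Nil [simp]: "word_map g [] x = x"
  and word_map_Cons [simp]: "word_map g (i # w) x = g i (word_map g w x)"
  by (simp_all add: word_map_def)

lemma finite_words: "finite (words N k)"
  using finite_lists_length_eq[of "{1..N}" k] by (simp add: words_def conj_commute)

lemma words_nonempty:
  assumes "N \<ge> 1"
  shows "words N k \<noteq> {}"
proof -
  have "replicate k 1 \<in> words N k"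
    using assms by (auto simp: words_def)
  then show ?thesis by blast
qed

lemma words_0: "words N 0 = {[]}"
  by (auto simp: words_def)

lemma words_Suc: "words N (Suc k) = (\<Union>i\<in>{1..N}. (#) i ` words N k)"
proof
  show "words N (Suc k) \<subseteq> (\<Union>i\<in>{1..N}. (#) i ` words N k)"
  proof
    fix w assume w: "w \<in> words N (Suc k)"
    then obtain i v where "w = i # v"
      by (cases w) (auto simp: words_def)
    then show "w \<in> (\<Union>i\<in>{1..N}. (#) i ` words N k)"
      using w by (auto simp: words_def)
  qed
qed (auto simp: words_def)

lemma hutchinson_funpow:
  "(hutchinson N g ^^ k) K = (\<Union>w\<in>words N k. word_map g w ` K)"
proof (induction k)
  case 0
  show ?case by (simp add: words_0)
next
  case (Suc k)
  have "(hutchinson N g ^^ Suc k) K = hutchinson N g (\<Union>w\<in>words N k. word_map g w ` K)"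
    using Suc by simp
  also have "\<dots> = (\<Union>i\<in>{1..N}. \<Union>w\<in>words N k. (\<lambda>x. g i (word_map g w x)) ` K)"
    by (auto simp: hutchinson_def)
  finally show ?case
    unfolding words_Suc by (simp add: image_image)
qed

lemma hutchinson_mono: "S \<subseteq> T \<Longrightarrow> hutchinson N g S \<subseteq> hutchinson N g T"
  by (auto simp: hutchinson_def)

lemma hutchinson_cong:
  "(\<And>i. i \<in> {1..N} \<Longrightarrow> g i = h i) \<Longrightarrow> hutchinson N g = hutchinson N h"
  unfolding hutchinson_def by (intro ext SUP_cong) auto

lemma infdist_le_hausdorff_distance:
  fixes S T :: "'a::metric_space set"
  assumes "bounded S" "T \<noteq> {}" "x \<in> S"
  shows "infdist x T \<le> hausdorff_distance S T"
proof -
  obtain y where "y \<in> T"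
    using assms by blast
  obtain B where "\<And>x. x \<in> S \<Longrightarrow> dist x y \<le> B"
    using assms(1) by (metis bounded_any_center dist_commute)
  then have "bdd_above ((\<lambda>x. infdist x T) ` S)"
    using infdist_le2[OF \<open>y \<in> T\<close>] by (intro bdd_aboveI2[where M = B]) auto
  then have "infdist x T \<le> (SUP x\<in>S. infdist x T)"
    by (rule cSUP_upper[OF assms(3)])
  then show ?thesis
    unfolding hausdorff_distance_def by simp
qed

lemma hausdorff_distance_commute: "hausdorff_distance S T = hausdorff_distance T S"
  by (simp add: hausdorff_distance_def max.commute)

lemma hausdorff_distance_0_subset:
  fixes S T :: "'a::metric_space set"
  assumes "bounded S" "closed T" "T \<noteq> {}" "hausdorff_distance S T = 0"
  shows "S \<subseteq> T"
proof
  fix x assume "x \<in> S"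
  then have "infdist x T \<le> 0"
    using infdist_le_hausdorff_distance[OF assms(1,3)] assms(4) by simp
  then show "x \<in> T"
    using in_closed_iff_infdist_zero[OF assms(2,3)] infdist_nonneg[of x T] by simp
qed

text \<open>The invariant set is obtained as a greatest fixed point, after Knaster and Tarski: the union of all
bounded sets that are covered by their own images.\<close>

definition ifs_attractor :: "nat \<Rightarrow> (nat \<Rightarrow> 'a \<Rightarrow> 'a) \<Rightarrow> 'a::metric_space set" where
  "ifs_attractor N g = \<Union> {S. bounded S \<and> S \<subseteq> hutchinson N g S}"

text \<open>Only long compositions need to contract, as the individual maps may expand in the Euclidean norm
although the joint spectral radius is less than one. The fixed point provides a first non-empty set
that is covered by its images.\<close>

locale contractive_ifs =
  fixes N :: nat and g :: "nat \<Rightarrow> 'a::heine_borel \<Rightarrow> 'a"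
  assumes continuous: "\<And>i. i \<in> {1..N} \<Longrightarrow> continuous_on UNIV (g i)"
    and fixed_point: "\<exists>i\<in>{1..N}. \<exists>p. g i p = p"
    and contractive: "\<And>e. e > 0 \<Longrightarrow> \<forall>\<^sub>F n in sequentially. \<forall>w\<in>words N n. \<forall>x y.
      dist (word_map g w x) (word_map g w y) \<le> e * dist x y"
begin

abbreviation "A \<equiv> ifs_attractor N g"

lemma compact_hutchinson: "compact K \<Longrightarrow> compact (hutchinson N g K)"
  unfolding hutchinson_def
  by (intro compact_UN compact_continuous_image finite_atLeastAtMost ballI
      continuous_on_subset[OF continuous subset_UNIV])

lemma bounded_hutchinson:
  assumes "bounded S"
  shows "bounded (hutchinson N g S)"
proof -
  have "compact (hutchinson N g (closure S))"
    using assms compact_hutchinson compact_closure by blast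
  then show ?thesis
    by (meson bounded_subset closure_subset compact_imp_bounded hutchinson_mono)
qed

lemma in_attractorI: "bounded S \<Longrightarrow> S \<subseteq> hutchinson N g S \<Longrightarrow> S \<subseteq> A"
  unfolding ifs_attractor_def by (rule Union_upper) simp

lemma fixed_point_in_attractor:
  assumes "i \<in> {1..N}" "g i p = p"
  shows "p \<in> A"
proof -
  have "g i p \<in> hutchinson N g {p}"
    using assms(1) unfolding hutchinson_def by blast
  then have "{p} \<subseteq> hutchinson N g {p}"
    using assms(2) by simp
  then have "{p} \<subseteq> A"
    by (intro in_attractorI) auto
  then show ?thesis
    by simp
qed

lemma attractor_nonempty: "A \<noteq> {}"
proof -
  obtain i p where "i \<in> {1..N}" "g i p = p"
    using fixed_point by auto
  then show ?thesis
    using fixed_point_in_attractor by auto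
qed

text \<open>If all words of some length \<open>n\<close> contract by \<open>1/2\<close>, then a bounded set \<open>S\<close> covered by its images has a
radius \<open>s\<close> around \<open>p\<close> with \<open>s \<le> s / 2 + m\<close>, where \<open>m\<close> does not depend on \<open>S\<close>. So the sets whose union is
taken are uniformly bounded.\<close>

lemma bounded_attractor: "bounded A"
proof -
  obtain p where "p \<in> A"
    using attractor_nonempty by blast
  have "\<exists>n. \<forall>w\<in>words N n. \<forall>x y. dist (word_map g w x) (word_map g w y) \<le> 1/2 * dist x y"
    using contractive[of "1/2"] eventually_happens'[OF sequentially_bot] by simp
  then obtain n where n: "\<And>w x y. w \<in> words N n \<Longrightarrow>
      dist (word_map g w x) (word_map g w y) \<le> 1/2 * dist x y"
    by blast
  define m where "m = (\<Sum>w\<in>words N n. dist (word_map g w p) p)"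
  have "S \<subseteq> cball p (2 * m)" if S: "bounded S" "S \<subseteq> hutchinson N g S" for S
  proof (cases "S = {}")
    case False
    have "S \<subseteq> (hutchinson N g ^^ n) S"
    proof (induction n)
      case (Suc n)
      then show ?case
        using S(2) hutchinson_mono[OF Suc] by simp blast
    qed simp
    obtain B where B: "\<And>x. x \<in> S \<Longrightarrow> dist x p \<le> B"
      using S(1) by (metis bounded_any_center dist_commute)
    then have bdd: "bdd_above ((\<lambda>x. dist x p) ` S)"
      by (auto simp: bdd_above_def)
    define s where "s = (SUP x\<in>S. dist x p)"
    have "s \<le> s / 2 + m"
      unfolding s_def
    proof (rule cSUP_least)
      fix x assume "x \<in> S"
      then obtain w y where w: "w \<in> words N n" "y \<in> S" "x = word_map g w y"
        using \<open>S \<subseteq> (hutchinson N g ^^ n) S\<close> by (auto simp: hutchinson_funpow)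
      have "dist x p \<le> dist (word_map g w y) (word_map g w p) + dist (word_map g w p) p"
        using w dist_triangle by blast
      also have "dist (word_map g w y) (word_map g w p) \<le> 1/2 * dist y p"
        using n w by blast
      also have "dist y p \<le> (SUP x\<in>S. dist x p)"
        by (rule cSUP_upper[OF w(2) bdd])
      also have "dist (word_map g w p) p \<le> m"
        unfolding m_def by (rule member_le_sum) (use w finite_words in auto)
      finally show "dist x p \<le> (SUP x\<in>S. dist x p) / 2 + m" by simp
    qed (use False in auto)
    then have "s \<le> 2 * m" by simp
    then show ?thesis
      using bdd unfolding s_def by (auto simp: dist_commute intro: order_trans[OF cSUP_upper])
  qed simp
  then have "A \<subseteq> cball p (2 * m)"
    unfolding ifs_attractor_def by (intro Union_least) simp
  then show ?thesis
    using bounded_cball bounded_subset by blast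
qed

lemma hutchinson_attractor: "hutchinson N g A = A"
proof
  show sub: "A \<subseteq> hutchinson N g A"
  proof
    fix x assume "x \<in> A"
    then obtain S where S: "x \<in> S" "bounded S" "S \<subseteq> hutchinson N g S"
      unfolding ifs_attractor_def by auto
    then have "hutchinson N g S \<subseteq> hutchinson N g A"
      by (intro hutchinson_mono in_attractorI)
    then show "x \<in> hutchinson N g A"
      using S by auto
  qed
  show "hutchinson N g A \<subseteq> A"
    by (intro in_attractorI bounded_hutchinson bounded_attractor hutchinson_mono sub)
qed

text \<open>The closure of \<open>A\<close> is bounded and again covered by its own images, so maximality makes \<open>A\<close> closed.\<close>

lemma compact_attractor: "compact A"
proof -
  have "compact (closure A)"
    using bounded_attractor compact_closure by blast
  then have "closed (hutchinson N g (closure A))"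
    using compact_hutchinson compact_imp_closed by blast
  moreover have "A \<subseteq> hutchinson N g (closure A)"
    using hutchinson_attractor hutchinson_mono[OF closure_subset] by blast
  ultimately have "closure A \<subseteq> hutchinson N g (closure A)"
    by (simp add: closure_minimal)
  then have "closure A \<subseteq> A"
    using bounded_attractor by (intro in_attractorI) auto
  then show ?thesis
    using \<open>compact (closure A)\<close> closure_subset by (metis subset_antisym)
qed

lemma funpow_hutchinson_attractor: "(hutchinson N g ^^ k) A = A"
  by (induction k) (simp_all add: hutchinson_attractor)

text \<open>A point of the \<open>n\<close>-th iterate of \<open>K\<close> is \<open>f\<^sub>w(x)\<close> for a word \<open>w\<close> and some \<open>x\<close> in \<open>K\<close>, and a point of \<open>A\<close> is
\<open>f\<^sub>w(a)\<close>, since \<open>A\<close> is invariant. Points with the same word \<open>w\<close> are close to each other.\<close>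

lemma eventually_near_attractor:
  assumes "compact K" "K \<noteq> {}" "e > 0"
  shows "\<forall>\<^sub>F n in sequentially.
    (\<forall>x\<in>(hutchinson N g ^^ n) K. \<exists>a\<in>A. dist x a \<le> e) \<and>
    (\<forall>a\<in>A. \<exists>x\<in>(hutchinson N g ^^ n) K. dist a x \<le> e)"
proof -
  obtain x0 a0 where x0: "x0 \<in> K" and a0: "a0 \<in> A"
    using assms attractor_nonempty by blast
  define d where "d = diameter (K \<union> A) + 1"
  have bnd: "bounded (K \<union> A)"
    using assms compact_attractor compact_imp_bounded by blast
  have d: "dist x a \<le> d" if "x \<in> K" "a \<in> A" for x a
    using diameter_bounded_bound[OF bnd, of x a] that by (simp add: d_def)
  have "d > 0"
    using diameter_ge_0[OF bnd] by (simp add: d_def)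
  then have "\<forall>\<^sub>F n in sequentially. \<forall>w\<in>words N n. \<forall>x y.
      dist (word_map g w x) (word_map g w y) \<le> e / d * dist x y"
    using contractive[of "e / d"] \<open>e > 0\<close> by simp
  then show ?thesis
  proof eventually_elim
    case (elim n)
    have close: "dist (word_map g w x) (word_map g w a) \<le> e"
      if "w \<in> words N n" "x \<in> K" "a \<in> A" for w x a
    proof -
      have "dist (word_map g w x) (word_map g w a) \<le> e / d * dist x a"
        using elim that by blast
      also have "\<dots> \<le> e / d * d"
        using d[OF that(2,3)] \<open>d > 0\<close> \<open>e > 0\<close> by (intro mult_left_mono) auto
      finally show ?thesis
        using \<open>d > 0\<close> by simp
    qed
    have wA: "word_map g w a \<in> A" if "w \<in> words N n" "a \<in> A" for w a
    proof -
      have "word_map g w a \<in> (hutchinson N g ^^ n) A"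
        unfolding hutchinson_funpow using that by blast
      then show ?thesis
        by (simp add: funpow_hutchinson_attractor)
    qed
    have "\<exists>a\<in>A. dist x a \<le> e" if x: "x \<in> (hutchinson N g ^^ n) K" for x
    proof -
      obtain w y where "w \<in> words N n" "y \<in> K" "x = word_map g w y"
        using x by (auto simp: hutchinson_funpow)
      then show ?thesis
        using close[OF _ _ a0] wA[OF _ a0] by blast
    qed
    moreover have "\<exists>x\<in>(hutchinson N g ^^ n) K. dist a x \<le> e" if a: "a \<in> A" for a
    proof -
      have "a \<in> (\<Union>w\<in>words N n. word_map g w ` A)"
        using a funpow_hutchinson_attractor[of n] by (simp flip: hutchinson_funpow)
      then obtain w b where "w \<in> words N n" "b \<in> A" "a = word_map g w b"
        by blast
      then have "word_map g w x0 \<in> (hutchinson N g ^^ n) K" "dist a (word_map g w x0) \<le> e"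
        using close[OF _ x0] x0 by (auto simp: hutchinson_funpow dist_commute)
      then show ?thesis by blast
    qed
    ultimately show ?case by blast
  qed
qed

lemma attractor_minimal:
  assumes "compact K" "K \<noteq> {}" "hutchinson N g K \<subseteq> K"
  shows "A \<subseteq> K"
proof
  fix a assume "a \<in> A"
  have iter: "(hutchinson N g ^^ n) K \<subseteq> K" for n
  proof (induction n)
    case (Suc n)
    then show ?case
      using assms(3) hutchinson_mono[OF Suc] by simp blast
  qed simp
  have "\<exists>x\<in>K. dist x a < e" if "e > 0" for e
  proof -
    have "e / 2 > 0" using that by simp
    obtain n where "\<exists>x\<in>(hutchinson N g ^^ n) K. dist a x \<le> e / 2"
      using eventually_happens'[OF sequentially_bot
          eventually_near_attractor[OF assms(1,2) \<open>e / 2 > 0\<close>]] \<open>a \<in> A\<close> by blast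
    then obtain x where "x \<in> K" "dist a x \<le> e / 2"
      using iter by blast
    then show ?thesis
      using that by (intro bexI[of _ x]) (auto simp: dist_commute)
  qed
  then have "a \<in> closure K"
    by (simp add: closure_approachable)
  then show "a \<in> K"
    using assms(1) by (simp add: compact_imp_closed)
qed

text \<open>The two halves of the preceding estimate bound the two suprema in the Hausdorff distance.\<close>

lemma is_attractor_attractor: "is_attractor N g A"
  unfolding is_attractor_def
proof (intro conjI allI impI attractor_nonempty compact_attractor)
  fix K :: "'a set"
  assume K: "K \<noteq> {} \<and> compact K"
  have ne: "(hutchinson N g ^^ n) K \<noteq> {}" for n
    using K fixed_point by (induction n) (auto simp: hutchinson_def)
  show "(\<lambda>n. hausdorff_distance ((hutchinson N g ^^ n) K) A) \<longlonglongrightarrow> 0"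
  proof (rule tendstoI)
    fix e :: real assume "e > 0"
    then have "\<forall>\<^sub>F n in sequentially.
      (\<forall>x\<in>(hutchinson N g ^^ n) K. \<exists>a\<in>A. dist x a \<le> e / 2) \<and>
      (\<forall>a\<in>A. \<exists>x\<in>(hutchinson N g ^^ n) K. dist a x \<le> e / 2)"
      using K eventually_near_attractor[of K "e / 2"] by simp
    then show "\<forall>\<^sub>F n in sequentially. dist (hausdorff_distance ((hutchinson N g ^^ n) K) A) 0 < e"
    proof eventually_elim
      case (elim n)
      define S where "S = (hutchinson N g ^^ n) K"
      have 1: "infdist x A \<le> e / 2" if "x \<in> S" for x
        using elim that infdist_le2 unfolding S_def by blast
      have 2: "infdist a S \<le> e / 2" if "a \<in> A" for a
        using elim that infdist_le2 unfolding S_def by blast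
      have "(SUP x\<in>S. infdist x A) \<le> e / 2"
        using 1 ne S_def by (intro cSUP_least) auto
      moreover have "(SUP a\<in>A. infdist a S) \<le> e / 2"
        using 2 attractor_nonempty by (intro cSUP_least)
      moreover have "0 \<le> (SUP x\<in>S. infdist x A)"
      proof -
        obtain x where "x \<in> S"
          using ne S_def by blast
        moreover have "bdd_above ((\<lambda>x. infdist x A) ` S)"
          using 1 by (intro bdd_aboveI2)
        ultimately show ?thesis
          using cSUP_upper[of x S "\<lambda>x. infdist x A"] infdist_nonneg[of x A] by linarith
      qed
      ultimately show ?case
        using \<open>e > 0\<close> unfolding hausdorff_distance_def S_def[symmetric] by (auto simp: dist_real_def)
    qed
  qed
qed

text \<open>Iterating the invariant set \<open>A\<close> itself gives a constant sequence, which can only converge to \<open>A\<close>.\<close>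

lemma attractor_unique:
  assumes "is_attractor N g B"
  shows "B = A"
proof -
  have B: "B \<noteq> {}" "compact B"
    and lim: "(\<lambda>k. hausdorff_distance ((hutchinson N g ^^ k) A) B) \<longlonglongrightarrow> 0"
    using assms attractor_nonempty compact_attractor unfolding is_attractor_def by blast+
  have zero: "hausdorff_distance A B = 0"
    using lim by (simp add: funpow_hutchinson_attractor LIMSEQ_const_iff)
  show ?thesis
  proof
    show "A \<subseteq> B"
      using B zero compact_imp_closed bounded_attractor by (intro hausdorff_distance_0_subset) auto
    show "B \<subseteq> A"
      using B zero compact_imp_bounded compact_attractor compact_imp_closed attractor_nonempty
      by (intro hausdorff_distance_0_subset) (auto simp: hausdorff_distance_commute)
  qed
qed

lemma the_attractor: "(THE B. is_attractor N g B) = A"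
  by (rule the_equality[of "is_attractor N g", OF is_attractor_attractor attractor_unique])

end

section \<open>Weak connectivity and coverings by the pieces of the hull\<close>

lemma convex_hull_inner_bounds:
  fixes S :: "'a::euclidean_space set"
  assumes "x \<in> convex hull S"
  obtains a b where "a \<in> S" "b \<in> S" "c \<bullet> a \<le> c \<bullet> x" "c \<bullet> x \<le> c \<bullet> b"
proof -
  have "\<exists>b\<in>S. d \<bullet> x \<le> d \<bullet> b" for d
  proof (rule ccontr)
    assume "\<not> (\<exists>b\<in>S. d \<bullet> x \<le> d \<bullet> b)"
    then have "S \<subseteq> {y. d \<bullet> y < d \<bullet> x}"
      by auto
    then have "convex hull S \<subseteq> {y. d \<bullet> y < d \<bullet> x}"
      by (rule hull_minimal) (rule convex_halfspace_lt)
    then show False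
      using assms by auto
  qed
  from this[of c] this[of "- c"] show ?thesis
    using that by auto
qed

text \<open>The maps of a semi-linear family, for an upper bound \<open>T\<close> of the parameters that plays the part of
\<open>t\<^sub>0\<close>. The joint spectral radius enters only through the assumption that long words contract.\<close>

locale pencil =
  fixes N :: nat and L :: "nat \<Rightarrow> 'a::euclidean_space \<Rightarrow> 'a" and q :: "nat \<Rightarrow> 'a" and T :: real
  assumes N_pos: "1 \<le> N"
    and linear_L: "\<And>i. i \<in> {1..N} \<Longrightarrow> linear (L i)"
    and words_contract: "\<And>t e. 0 < t \<Longrightarrow> t < T \<Longrightarrow> 0 < e \<Longrightarrow>
      \<forall>\<^sub>F n in sequentially. \<forall>w\<in>words N n. \<forall>x. t ^ n * norm (word_map L w x) \<le> e * norm x"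
begin

definition g :: "real \<Rightarrow> nat \<Rightarrow> 'a \<Rightarrow> 'a" where
  "g t i x = q i + t *\<^sub>R L i (x - q i)"

abbreviation att :: "real \<Rightarrow> 'a set" where
  "att t \<equiv> ifs_attractor N (g t)"

abbreviation K :: "real \<Rightarrow> 'a set" where
  "K t \<equiv> convex hull att t"

lemma g_fixed [simp]: "i \<in> {1..N} \<Longrightarrow> g t i (q i) = q i"
  using linear_0[OF linear_L] by (simp add: g_def)

lemma g_diff: "i \<in> {1..N} \<Longrightarrow> g t i x - g t i y = t *\<^sub>R L i (x - y)"
  using linear_diff[OF linear_L, of i "x - q i" "y - q i"]
  by (simp add: g_def scaleR_diff_right)

lemma word_map_g_diff:
  assumes "set w \<subseteq> {1..N}"
  shows "word_map (g t) w x - word_map (g t) w y = t ^ length w *\<^sub>R word_map L w (x - y)"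
  using assms
proof (induction w)
  case (Cons i w)
  have i: "i \<in> {1..N}" and w: "set w \<subseteq> {1..N}"
    using Cons.prems by auto
  have "word_map (g t) (i # w) x - word_map (g t) (i # w) y
      = t *\<^sub>R L i (t ^ length w *\<^sub>R word_map L w (x - y))"
    by (simp only: word_map_Cons g_diff[OF i] Cons.IH[OF w])
  also have "\<dots> = t ^ length (i # w) *\<^sub>R word_map L (i # w) (x - y)"
    by (simp add: linear_scale[OF linear_L[OF i]])
  finally show ?case .
qed simp

lemma continuous_on_L:
  assumes "i \<in> {1..N}"
  shows "continuous_on S (\<lambda>x. L i (x - q i))"
  by (rule linear_continuous_on_compose[OF _ linear_L[OF assms]]) (intro continuous_intros)

lemma continuous_on_g: "i \<in> {1..N} \<Longrightarrow> continuous_on S (g t i)"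
  unfolding g_def by (intro continuous_intros continuous_on_L)

lemma g_convex_combination:
  assumes "i \<in> {1..N}" "u + v = 1"
  shows "g t i (u *\<^sub>R x + v *\<^sub>R y) = u *\<^sub>R g t i x + v *\<^sub>R g t i y"
proof -
  have "u *\<^sub>R x + v *\<^sub>R y - q i = u *\<^sub>R (x - q i) + v *\<^sub>R (y - q i)"
    using assms(2) by (simp add: algebra_simps flip: scaleR_add_left)
  then have "g t i (u *\<^sub>R x + v *\<^sub>R y)
      = (u + v) *\<^sub>R q i + t *\<^sub>R (u *\<^sub>R L i (x - q i) + v *\<^sub>R L i (y - q i))"
    using assms(2) linear_add[OF linear_L[OF assms(1)]] linear_scale[OF linear_L[OF assms(1)]]
    by (simp add: g_def)
  then show ?thesis
    by (simp add: g_def algebra_simps)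
qed

lemma g_image_convex_hull:
  assumes "i \<in> {1..N}" "g t i ` S \<subseteq> C" "convex C"
  shows "g t i ` (convex hull S) \<subseteq> C"
proof -
  have "convex (g t i -` C)"
    using assms unfolding convex_def by (auto simp: g_convex_combination)
  then have "convex hull S \<subseteq> g t i -` C"
    using assms(2) by (intro hull_minimal) auto
  then show ?thesis by auto
qed

lemma contractive_ifs_g:
  assumes "0 < t" "t < T"
  shows "contractive_ifs N (g t)"
proof
  show "\<exists>i\<in>{1..N}. \<exists>p. g t i p = p"
    using N_pos g_fixed by (meson atLeastAtMost_iff order_refl)
  fix e :: real assume "e > 0"
  from words_contract[OF assms this]
  show "\<forall>\<^sub>F n in sequentially. \<forall>w\<in>words N n. \<forall>x y.
      dist (word_map (g t) w x) (word_map (g t) w y) \<le> e * dist x y"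
  proof eventually_elim
    case (elim n)
    then show ?case
      using assms by (auto simp: words_def dist_norm word_map_g_diff)
  qed
qed (rule continuous_on_g)

text \<open>The value \<open>v\<close> belongs to one of the intervals \<open>J\<^sub>i(t)\<close>, the images of the pieces of the hull under the
functional given by \<open>c\<close>.\<close>

definition covered :: "real \<Rightarrow> 'a \<Rightarrow> real \<Rightarrow> bool" where
  "covered t c v \<longleftrightarrow> (\<exists>i\<in>{1..N}. \<exists>x\<in>K t. c \<bullet> g t i x = v)"

context
  fixes t assumes t: "0 < t" "t < T"
begin

interpretation contractive_ifs N "g t"
  by (rule contractive_ifs_g[OF t])

lemma compact_att: "compact (att t)"
  by (rule compact_attractor)

lemma compact_K: "compact (K t)"
  using compact_att by (rule compact_convex_hull)

lemma hutchinson_att: "hutchinson N (g t) (att t) = att t"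
  by (rule hutchinson_attractor)

lemma the_attractor_att: "(THE A. is_attractor N (g t) A) = att t"
  by (rule the_attractor)

lemma att_minimal: "compact S \<Longrightarrow> S \<noteq> {} \<Longrightarrow> hutchinson N (g t) S \<subseteq> S \<Longrightarrow> att t \<subseteq> S"
  by (rule attractor_minimal)

lemma q_in_att: "i \<in> {1..N} \<Longrightarrow> q i \<in> att t"
  by (rule fixed_point_in_attractor) auto

lemma q_in_K: "i \<in> {1..N} \<Longrightarrow> q i \<in> K t"
  using q_in_att by (simp add: hull_inc)

lemma g_in_att:
  assumes "i \<in> {1..N}" "x \<in> att t"
  shows "g t i x \<in> att t"
proof -
  have "g t i x \<in> hutchinson N (g t) (att t)"
    using assms unfolding hutchinson_def by blast
  then show ?thesis
    by (simp add: hutchinson_att)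
qed

lemma att_cases:
  assumes "x \<in> att t"
  obtains i y where "i \<in> {1..N}" "y \<in> att t" "x = g t i y"
proof -
  have "x \<in> hutchinson N (g t) (att t)"
    using assms by (simp add: hutchinson_att)
  then show ?thesis
    using that unfolding hutchinson_def by blast
qed

lemma g_in_K:
  assumes "i \<in> {1..N}" "x \<in> K t"
  shows "g t i x \<in> K t"
proof -
  have "g t i ` att t \<subseteq> K t"
    using assms g_in_att hull_subset[of "att t" convex] by blast
  then show ?thesis
    using g_image_convex_hull[OF assms(1)] assms(2) by blast
qed

end

lemma covered_interval:
  assumes t: "0 < t" "t < T" and i: "i \<in> {1..N}" and xy: "x \<in> K t" "y \<in> K t"
    and v: "c \<bullet> g t i x \<le> v" "v \<le> c \<bullet> g t i y"
  shows "covered t c v"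
proof -
  have "connected (g t i ` K t)"
    by (intro connected_continuous_image continuous_on_g[OF i] convex_connected) simp
  then have "\<exists>z\<in>g t i ` K t. c \<bullet> z = v"
    using xy v by (intro connected_ivt_hyperplane[of _ "g t i x" "g t i y"]) auto
  then show ?thesis
    using i covered_def by auto
qed

text \<open>The hull \<open>K t\<close> is mapped into itself by the maps at \<open>s\<close> too, because these send \<open>x\<close> to a convex
combination of the centre and of the image of \<open>x\<close> at \<open>t\<close>; it therefore contains the attractor at \<open>s\<close>.\<close>

lemma K_mono:
  assumes "0 < s" "s \<le> t" "t < T"
  shows "K s \<subseteq> K t"
proof -
  have t: "0 < t" "t < T" and s: "0 < s" "s < T"
    using assms by auto
  have "att s \<subseteq> K t"
  proof (rule att_minimal[OF s])
    show "compact (K t)"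
      by (rule compact_K[OF t])
    have "1 \<in> {1..N}"
      using N_pos by simp
    then show "K t \<noteq> {}"
      using q_in_K[OF t] by blast
    have "g s i x \<in> K t" if i: "i \<in> {1..N}" and x: "x \<in> K t" for i x
    proof -
      have "g s i x = (1 - s / t) *\<^sub>R q i + (s / t) *\<^sub>R g t i x"
        using t by (simp add: g_def algebra_simps)
      also have "\<dots> \<in> K t"
        using assms t q_in_K[OF t i] g_in_K[OF t i x] by (intro convexD) auto
      finally show ?thesis .
    qed
    then show "hutchinson N (g s) (K t) \<subseteq> K t"
      unfolding hutchinson_def by blast
  qed
  then show ?thesis
    by (intro hull_minimal) auto
qed

text \<open>Instead of shrinking the map, one may shrink its argument towards the centre.\<close>

lemma g_K_mono:
  assumes st: "0 < s" "s \<le> t" "t < T" and i: "i \<in> {1..N}" and x: "x \<in> K s"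
  shows "\<exists>y\<in>K t. g t i y = g s i x"
proof -
  have t: "0 < t" "t < T" and s: "0 < s" "s < T"
    using st by auto
  define y where "y = (1 - s / t) *\<^sub>R q i + (s / t) *\<^sub>R x"
  have "y \<in> K s"
    using st x q_in_K[OF s i] unfolding y_def by (intro convexD) auto
  then have "y \<in> K t"
    using K_mono[OF st] by blast
  moreover have "y - q i = (s / t) *\<^sub>R (x - q i)"
    by (simp add: y_def algebra_simps)
  then have "g t i y = g s i x"
    using t linear_scale[OF linear_L[OF i]] by (simp add: g_def)
  ultimately show ?thesis by blast
qed

lemma covered_mono:
  assumes st: "0 < s" "s \<le> t" "t < T" and "covered s c v"
  shows "covered t c v"
proof -
  have t: "0 < t" "t < T" and s: "0 < s" "s < T"
    using st by auto
  obtain i x where "i \<in> {1..N}" "x \<in> K s" "c \<bullet> g s i x = v"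
    using assms(4) covered_def by blast
  then show ?thesis
    using g_K_mono[OF st] unfolding covered_def by metis
qed

text \<open>The covering property propagates along the iteration, because composing a functional with a map of the
family gives another functional (by the adjoint of the linear part), to which the induction hypothesis
applies. This is why the property has to be assumed for all directions at once.\<close>

lemma covered_in_word_images:
  assumes t: "0 < t" "t < T"
    and cov: "\<And>c x. x \<in> K t \<Longrightarrow> covered t c (c \<bullet> x)"
    and x: "x \<in> K t"
  shows "\<exists>y\<in>(hutchinson N (g t) ^^ n) (K t). c \<bullet> y = c \<bullet> x"
  using x
proof (induction n arbitrary: c x)
  case (Suc n)
  obtain i y where i: "i \<in> {1..N}" and y: "y \<in> K t" "c \<bullet> g t i y = c \<bullet> x"
    using cov[OF Suc.prems] covered_def by metis
  define c' where "c' = t *\<^sub>R adjoint (L i) c"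
  have adj: "c \<bullet> L i z = adjoint (L i) c \<bullet> z" for z
    using adjoint_works[OF linear_L[OF i], of z c] by (simp add: inner_commute)
  obtain z where z: "z \<in> (hutchinson N (g t) ^^ n) (K t)" "c' \<bullet> z = c' \<bullet> y"
    using Suc.IH[OF y(1)] by blast
  have "c \<bullet> g t i z = c \<bullet> g t i y"
    using z(2) by (simp add: g_def c'_def adj inner_add_right inner_diff_right)
  moreover have "g t i z \<in> (hutchinson N (g t) ^^ Suc n) (K t)"
    using i z(1) by (auto simp: hutchinson_def)
  ultimately show ?case
    using y(2) by metis
qed auto

text \<open>The iterates of \<open>K t\<close> approach the attractor, so the previous lemma survives in the limit.\<close>

lemma inner_K_in_att:
  assumes t: "0 < t" "t < T"
    and cov: "\<And>c x. x \<in> K t \<Longrightarrow> covered t c (c \<bullet> x)"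
    and x: "x \<in> K t"
  shows "c \<bullet> x \<in> (\<lambda>a. c \<bullet> a) ` att t"
proof -
  interpret contractive_ifs N "g t"
    by (rule contractive_ifs_g[OF t])
  have "\<exists>a\<in>att t. dist (c \<bullet> a) (c \<bullet> x) < e" if "e > 0" for e
  proof -
    define d where "d = e / (2 * (norm c + 1))"
    have "d > 0"
      using that by (simp add: d_def add_nonneg_pos)
    obtain n where n: "\<forall>y\<in>(hutchinson N (g t) ^^ n) (K t). \<exists>a\<in>att t. dist y a \<le> d"
      using eventually_happens'[OF sequentially_bot
          eventually_near_attractor[OF compact_K[OF t] _ \<open>d > 0\<close>]] x by blast
    obtain y where y: "y \<in> (hutchinson N (g t) ^^ n) (K t)" "c \<bullet> y = c \<bullet> x"
      using covered_in_word_images[OF t cov x] by blast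
    obtain a where a: "a \<in> att t" "dist y a \<le> d"
      using n y(1) by blast
    have "dist (c \<bullet> a) (c \<bullet> x) = \<bar>c \<bullet> (a - y)\<bar>"
      using y(2) by (simp add: dist_real_def inner_diff_right)
    also have "\<dots> \<le> norm c * norm (a - y)"
      by (rule Cauchy_Schwarz_ineq2)
    also have "\<dots> \<le> (norm c + 1) * d"
      using a(2) by (intro mult_mono) (auto simp: dist_norm norm_minus_commute)
    also have "\<dots> = e / 2"
      by (simp add: d_def field_simps add_nonneg_eq_0_iff)
    also have "\<dots> < e"
      using that by simp
    finally show ?thesis
      using a(1) by blast
  qed
  then have "c \<bullet> x \<in> closure ((\<lambda>a. c \<bullet> a) ` att t)"
    unfolding closure_approachable by blast
  moreover have "closed ((\<lambda>a. c \<bullet> a) ` att t)"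
    by (intro compact_imp_closed compact_continuous_image compact_att[OF t] continuous_intros)
  ultimately show ?thesis by simp
qed

lemma weakly_connected_if_covered:
  assumes t: "0 < t" "t < T"
    and cov: "\<And>c x. x \<in> K t \<Longrightarrow> covered t c (c \<bullet> x)"
  shows "weakly_connected (att t)"
  unfolding weakly_connected_def
proof clarify
  fix c :: 'a and b
  assume "hyperplane_separates c b (att t)"
  then obtain x y where xy: "x \<in> att t" "c \<bullet> x < b" "y \<in> att t" "b < c \<bullet> y"
    and disj: "\<And>z. z \<in> att t \<Longrightarrow> c \<bullet> z \<noteq> b"
    unfolding hyperplane_separates_def by blast
  have "\<exists>z\<in>K t. c \<bullet> z = b"
    using xy by (intro connected_ivt_hyperplane[of _ x y])
      (auto simp: convex_connected hull_inc)
  then obtain z where z: "z \<in> K t" "c \<bullet> z = b"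
    by blast
  obtain a where "a \<in> att t" "c \<bullet> z = c \<bullet> a"
    using inner_K_in_att[OF t cov z(1), of c] by (rule imageE)
  then show False
    using z(2) disj by metis
qed

lemma covered_if_weakly_connected:
  assumes t: "0 < t" "t < T" and wc: "weakly_connected (att t)" and x: "x \<in> K t"
  shows "covered t c (c \<bullet> x)"
proof -
  obtain a b where ab: "a \<in> att t" "b \<in> att t" "c \<bullet> a \<le> c \<bullet> x" "c \<bullet> x \<le> c \<bullet> b"
    using convex_hull_inner_bounds[OF x] by blast
  have "\<exists>z\<in>att t. c \<bullet> z = c \<bullet> x"
  proof (rule ccontr)
    assume no: "\<not> (\<exists>z\<in>att t. c \<bullet> z = c \<bullet> x)"
    then have "c \<bullet> a < c \<bullet> x" "c \<bullet> x < c \<bullet> b"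
      using ab by (auto simp: order.order_iff_strict)
    moreover from this have "c \<noteq> 0"
      by auto
    ultimately show False
      using no ab wc unfolding weakly_connected_def hyperplane_separates_def by blast
  qed
  then obtain z where "z \<in> att t" "c \<bullet> z = c \<bullet> x" by blast
  moreover obtain i y where "i \<in> {1..N}" "y \<in> att t" "z = g t i y"
    using att_cases[OF t \<open>z \<in> att t\<close>] by blast
  ultimately show ?thesis
    using hull_inc[of y "att t" convex] unfolding covered_def by blast
qed

text \<open>The extreme values of a functional on the hull are attained on the attractor, hence on some piece, and the
interval \<open>J\<^sub>i(t)\<close> of that piece reaches down (or up) to the value at its centre. What remains are the values
between two centres.\<close>

lemma weakly_connected_if_covered_between:
  assumes t: "0 < t" "t < T"
    and cov: "\<And>c i j v. i \<in> {1..N} \<Longrightarrow> j \<in> {1..N} \<Longrightarrow> c \<bullet> q j < v \<Longrightarrow> v < c \<bullet> q i \<Longrightarrow> covered t c v"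
  shows "weakly_connected (att t)"
proof (rule weakly_connected_if_covered[OF t])
  fix c x assume x: "x \<in> K t"
  obtain a b where ab: "a \<in> att t" "b \<in> att t" "c \<bullet> a \<le> c \<bullet> x" "c \<bullet> x \<le> c \<bullet> b"
    using convex_hull_inner_bounds[OF x] by blast
  obtain j a' where a': "j \<in> {1..N}" "a' \<in> att t" "a = g t j a'"
    using att_cases[OF t ab(1)] by blast
  obtain i b' where b': "i \<in> {1..N}" "b' \<in> att t" "b = g t i b'"
    using att_cases[OF t ab(2)] by blast
  have K: "a' \<in> K t" "b' \<in> K t" "q i \<in> K t" "q j \<in> K t"
    using a' b' q_in_K[OF t] by (auto simp: hull_inc)
  consider "c \<bullet> q i \<le> c \<bullet> x" | "c \<bullet> x \<le> c \<bullet> q j" | "c \<bullet> q j < c \<bullet> x" "c \<bullet> x < c \<bullet> q i"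
    by linarith
  then show "covered t c (c \<bullet> x)"
  proof cases
    case 1
    then show ?thesis
      using b' ab(4) K by (intro covered_interval[OF t b'(1), of "q i" b']) auto
  next
    case 2
    then show ?thesis
      using a' ab(3) K by (intro covered_interval[OF t a'(1), of a' "q j"]) auto
  next
    case 3
    then show ?thesis
      using cov a' b' by blast
  qed
qed

text \<open>Values between two centres lie in the image of the hull at \<open>s\<close>; they are covered at \<open>s\<close>, and coverings
persist for larger parameters.\<close>

theorem weakly_connected_mono:
  assumes "0 < s" "s \<le> t" "t < T" "weakly_connected (att s)"
  shows "weakly_connected (att t)"
proof -
  have t: "0 < t" "t < T" and s: "0 < s" "s < T"
    using assms by auto
  show ?thesis
  proof (rule weakly_connected_if_covered_between[OF t])
    fix c i j v
    assume ij: "i \<in> {1..N}" "j \<in> {1..N}" and v: "c \<bullet> q j < v" "v < c \<bullet> q i"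
    have "\<exists>x\<in>K s. c \<bullet> x = v"
      using v q_in_K[OF s] ij
      by (intro connected_ivt_hyperplane[of _ "q j" "q i"]) (auto simp: convex_connected)
    then show "covered t c v"
      using covered_if_weakly_connected[OF s assms(4)] covered_mono[OF assms(1-3)] by blast
  qed
qed

text \<open>The functional given by the difference of two distinct centres takes finitely many values on the centres,
so some value \<open>b\<close> between these two is avoided. The pieces of the attractor deviate from their centres
by at most a multiple of \<open>t\<close>, uniformly in \<open>t \<le> s\<close> as all these attractors lie in \<open>K s\<close>.\<close>

theorem strongly_disconnected_small:
  assumes T: "0 < T" and ij: "i \<in> {1..N}" "j \<in> {1..N}" "q i \<noteq> q j"
  shows "\<exists>e>0. e \<le> T \<and> (\<forall>t. 0 < t \<and> t < e \<longrightarrow> strongly_disconnected (att t))"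
proof -
  define s where "s = T / 2"
  have s: "0 < s" "s < T"
    using T by (auto simp: s_def)
  define c where "c = q i - q j"
  have "0 < c \<bullet> c"
    using ij(3) by (simp add: c_def)
  then have "c \<bullet> q j < c \<bullet> q i"
    by (simp add: c_def inner_diff_right)
  then have "infinite {c \<bullet> q j<..<c \<bullet> q i}"
    by (simp add: infinite_Ioo)
  moreover have "finite ((\<lambda>l. c \<bullet> q l) ` {1..N})"
    by simp
  ultimately have "{c \<bullet> q j<..<c \<bullet> q i} - (\<lambda>l. c \<bullet> q l) ` {1..N} \<noteq> {}"
    by (metis Diff_infinite_finite finite.emptyI)
  then obtain b where "b \<in> {c \<bullet> q j<..<c \<bullet> q i} - (\<lambda>l. c \<bullet> q l) ` {1..N}"
    by blast
  then have b: "c \<bullet> q j < b" "b < c \<bullet> q i" and bq: "\<And>l. l \<in> {1..N} \<Longrightarrow> c \<bullet> q l \<noteq> b"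
    by auto
  define d where "d = (MIN l\<in>{1..N}. \<bar>c \<bullet> q l - b\<bar>)"
  have d: "d \<le> \<bar>c \<bullet> q l - b\<bar>" if "l \<in> {1..N}" for l
    unfolding d_def using that by (intro Min_le) auto
  have "d > 0"
    unfolding d_def using bq ij(1) by (subst Min_gr_iff) auto
  have "\<exists>B. \<forall>x\<in>K s. norm (L l (x - q l)) \<le> B" if "l \<in> {1..N}" for l
  proof -
    have "compact ((\<lambda>x. L l (x - q l)) ` K s)"
      by (intro compact_continuous_image compact_K[OF s] continuous_on_L that)
    then show ?thesis
      using compact_imp_bounded bounded_iff by (metis (no_types, lifting) image_eqI)
  qed
  then obtain B where B: "\<And>l x. l \<in> {1..N} \<Longrightarrow> x \<in> K s \<Longrightarrow> norm (L l (x - q l)) \<le> B l"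
    by metis
  define M where "M = norm c * (\<Sum>l\<in>{1..N}. \<bar>B l\<bar>) + 1"
  have "M > 0"
    unfolding M_def by (intro add_nonneg_pos mult_nonneg_nonneg sum_nonneg) auto
  have M: "\<bar>c \<bullet> L l (x - q l)\<bar> < M" if "l \<in> {1..N}" "x \<in> K s" for l x
  proof -
    have "\<bar>c \<bullet> L l (x - q l)\<bar> \<le> norm c * norm (L l (x - q l))"
      by (rule Cauchy_Schwarz_ineq2)
    also have "norm (L l (x - q l)) \<le> \<bar>B l\<bar>"
      using B[OF that] by simp
    also have "\<bar>B l\<bar> \<le> (\<Sum>l\<in>{1..N}. \<bar>B l\<bar>)"
      by (rule member_le_sum) (use that in auto)
    finally show ?thesis
      unfolding M_def by (simp add: mult_left_mono)
  qed
  define e where "e = min s (d / M)"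
  have "strongly_disconnected (att t)" if te: "0 < t" "t < e" for t
  proof -
    have t: "0 < t" "t < T" and ts: "t \<le> s"
      using te s by (auto simp: e_def)
    have "t * M < d"
      using te \<open>M > 0\<close> by (simp add: e_def pos_less_divide_eq)
    have "c \<bullet> x \<noteq> b" if x: "x \<in> att t" for x
    proof -
      obtain l y where l: "l \<in> {1..N}" and y: "y \<in> att t" "x = g t l y"
        using att_cases[OF t x] by blast
      have "y \<in> K s"
        using y(1) K_mono[OF t(1) ts s(2)] hull_subset[of "att t" convex] by blast
      have "\<bar>c \<bullet> x - c \<bullet> q l\<bar> = t * \<bar>c \<bullet> L l (y - q l)\<bar>"
        using t by (simp add: y(2) g_def inner_add_right abs_mult)
      also have "\<dots> < t * M"
        using t M[OF l \<open>y \<in> K s\<close>] by simp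
      finally have "\<bar>c \<bullet> x - c \<bullet> q l\<bar> < \<bar>c \<bullet> q l - b\<bar>"
        using \<open>t * M < d\<close> d[OF l] by linarith
      then show ?thesis by auto
    qed
    then have "hyperplane_separates c b (att t)"
      using b q_in_att[OF t] ij unfolding hyperplane_separates_def by blast
    moreover have "c \<noteq> 0"
      using ij by (simp add: c_def)
    ultimately show ?thesis
      unfolding strongly_disconnected_def by blast
  qed
  moreover have "0 < e" "e \<le> T"
    using s \<open>M > 0\<close> \<open>d > 0\<close> by (auto simp: e_def)
  ultimately show ?thesis by blast
qed

text \<open>The last clause makes \<open>\<tau>\<close> the infimum of the weakly connected parameters, so that one such parameter
below \<open>T\<close> gives \<open>\<tau> < T\<close>.\<close>

lemma weakly_connected_threshold:
  assumes T: "0 < T" and ij: "i \<in> {1..N}" "j \<in> {1..N}" "q i \<noteq> q j"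
  shows "\<exists>\<tau>. 0 < \<tau> \<and> \<tau> \<le> T
    \<and> (\<forall>t. \<tau> < t \<and> t < T \<longrightarrow> weakly_connected (att t))
    \<and> (\<forall>t. 0 < t \<and> t < \<tau> \<longrightarrow> strongly_disconnected (att t))
    \<and> (\<forall>t. 0 < t \<and> t < T \<and> weakly_connected (att t) \<longrightarrow> \<tau> \<le> t)"
proof -
  have neg: "strongly_disconnected (att t) \<longleftrightarrow> \<not> weakly_connected (att t)" for t
    unfolding strongly_disconnected_def weakly_connected_def by simp
  obtain e where e: "0 < e" "e \<le> T" and small: "\<And>t. 0 < t \<Longrightarrow> t < e \<Longrightarrow> strongly_disconnected (att t)"
    using strongly_disconnected_small[OF T ij] by blast
  \<comment> \<open>Including \<open>T\<close> covers the case that no attractor is weakly connected.\<close>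
  define W where "W = insert T {t. 0 < t \<and> t < T \<and> weakly_connected (att t)}"
  have "e \<le> w" if "w \<in> W" for w
    using that e small neg unfolding W_def by (auto simp: not_less[symmetric])
  then have bdd: "bdd_below W" and "e \<le> Inf W"
    by (auto simp: W_def intro!: bdd_belowI cInf_greatest)
  show ?thesis
  proof (intro exI[of _ "Inf W"] conjI allI impI; (elim conjE)?)
    show "0 < Inf W"
      using e \<open>e \<le> Inf W\<close> by simp
    show "Inf W \<le> T"
      using bdd by (intro cInf_lower) (auto simp: W_def)
    show "weakly_connected (att t)" if "Inf W < t" "t < T" for t
    proof -
      have "W \<noteq> {}"
        by (simp add: W_def)
      from cInf_lessD[OF this that(1)] obtain w where "w \<in> W" "w < t"
        by blast
      then have "0 < w" "weakly_connected (att w)"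
        using that(2) by (auto simp: W_def)
      then show ?thesis
        using weakly_connected_mono[of w t] \<open>w < t\<close> that(2) by simp
    qed
    show "strongly_disconnected (att t)" if "0 < t" "t < Inf W" for t
    proof (rule ccontr)
      assume "\<not> strongly_disconnected (att t)"
      moreover have "t < T"
        using that \<open>Inf W \<le> T\<close> by simp
      ultimately have "t \<in> W"
        using that neg by (simp add: W_def)
      then show False
        using that cInf_lower[OF _ bdd] by fastforce
    qed
    show "Inf W \<le> t" if "0 < t" "t < T" "weakly_connected (att t)" for t
      using bdd that by (intro cInf_lower) (auto simp: W_def)
  qed
qed

end

section \<open>Similarities\<close>

lemma funpow_linear:
  fixes E :: "'a::real_vector \<Rightarrow> 'a"
  assumes "linear E"
  shows "linear (E ^^ n)"
proof (induction n)
  case 0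
  show ?case by (simp add: linear_ident)
next
  case (Suc n)
  then show ?case
    using linear_compose[OF Suc assms] by (simp add: o_def)
qed

lemma funpow_norm:
  fixes E :: "'a::real_normed_vector \<Rightarrow> 'a"
  assumes "\<And>x. norm (E x) = norm x"
  shows "norm ((E ^^ n) x) = norm x"
  by (induction n) (auto simp: assms)

text \<open>The powers of an isometry lie in a compact ball of operators, so two of them, \<open>E ^^ a\<close> and \<open>E ^^ b\<close>, are close to
each other, and then \<open>E ^^ (b - a)\<close> is close to the identity.\<close>

lemma linear_isometry_recurrent:
  fixes E :: "'a::euclidean_space \<Rightarrow> 'a"
  assumes lin: "linear E" and iso: "\<And>x. norm (E x) = norm x" and e: "e > 0"
  obtains m where "m \<ge> 1" "\<And>x. norm ((E ^^ m) x - x) \<le> e * norm x"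
proof -
  have bl: "bounded_linear (E ^^ n)" for n
    using funpow_linear[OF lin] by (simp add: linear_conv_bounded_linear)
  define X where "X n = Blinfun (E ^^ n)" for n
  have X: "blinfun_apply (X n) = E ^^ n" for n
    unfolding X_def by (rule bounded_linear_Blinfun_apply[OF bl])
  have "norm (X n) \<le> 1" for n
    by (rule norm_blinfun_bound) (simp_all add: X funpow_norm[OF iso])
  then have "bounded (range X)"
    by (auto simp: bounded_iff)
  then obtain l r where r: "strict_mono r" and "(X \<circ> r) \<longlonglongrightarrow> l"
    using bounded_imp_convergent_subsequence by blast
  then have "Cauchy (X \<circ> r)"
    by (intro convergent_Cauchy convergentI)
  then obtain M where M: "dist ((X \<circ> r) k) ((X \<circ> r) n) < e" if "k \<ge> M" "n \<ge> M" for k n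
    using e unfolding Cauchy_def by meson
  define a b where "a = r M" and "b = r (Suc M)"
  have "a < b"
    using r by (simp add: a_def b_def strict_mono_def)
  have dist: "norm (X b - X a) < e"
    using M[of "Suc M" M] by (simp add: a_def b_def dist_norm)
  show ?thesis
  proof
    show "b - a \<ge> 1"
      using \<open>a < b\<close> by simp
    fix x
    have "(E ^^ b) x = (E ^^ a) ((E ^^ (b - a)) x)"
      using \<open>a < b\<close> funpow_add[of a "b - a" E] by simp
    then have "norm ((E ^^ (b - a)) x - x) = norm ((E ^^ b) x - (E ^^ a) x)"
      using linear_diff[OF funpow_linear[OF lin, of a], of "(E ^^ (b - a)) x" x]
        funpow_norm[OF iso, of a "(E ^^ (b - a)) x - x"] by simp
    also have "\<dots> = norm (blinfun_apply (X b - X a) x)"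
      by (simp add: blinfun.diff_left X)
    also have "\<dots> \<le> norm (X b - X a) * norm x"
      by (rule norm_blinfun)
    also have "\<dots> \<le> e * norm x"
      using dist by (intro mult_right_mono) auto
    finally show "norm ((E ^^ (b - a)) x - x) \<le> e * norm x" .
  qed
qed

text \<open>As \<open>l\<close> is injective, the vectors \<open>l b\<close> for \<open>b\<close> in a basis \<open>B \<subseteq> D\<close> span the same space as \<open>D\<close>, so no non-zero
vector of this space is orthogonal to all of them. The frame operator \<open>F\<close> of these vectors turns this into a
quantitative statement: it is injective on the span, hence bounded below.\<close>

lemma spanning_image_inner_bound:
  fixes D :: "'a::euclidean_space set"
  assumes lin: "linear l" and inj: "inj l" and into: "l ` D \<subseteq> span D"
  shows "\<exists>d>0. \<forall>c\<in>span D. \<exists>b\<in>insert 0 D. d * norm c \<le> \<bar>c \<bullet> l b\<bar>"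
proof -
  obtain B where B: "B \<subseteq> D" "independent B" "D \<subseteq> span B" "card B = dim D"
    using basis_exists by blast
  have "finite B"
    using B(2) by (rule independent_imp_finite)
  have "span B = span D"
    using B(1,3) by (metis span_mono span_span subset_antisym span_eq)
  have "span (l ` B) = span D"
  proof (rule subspace_dim_equal)
    show "span (l ` B) \<subseteq> span D"
      using B(1) into by (intro span_minimal) auto
    have "dim (span (l ` B)) = dim (span B)"
      using inj lin by (simp add: linear_span_image dim_image_eq inj_on_subset)
    then show "dim (span D) \<le> dim (span (l ` B))"
      using \<open>span B = span D\<close> by simp
  qed auto
  define F where "F c = (\<Sum>b\<in>B. (c \<bullet> l b) *\<^sub>R l b)" for c
  have "bounded_linear F"
    unfolding F_def by (intro bounded_linear_intros)
  moreover have "c = 0" if "c \<in> span D" "F c = 0" for c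
  proof -
    have "0 = c \<bullet> F c"
      using that by simp
    also have "\<dots> = (\<Sum>b\<in>B. (c \<bullet> l b)\<^sup>2)"
      by (simp add: F_def inner_sum_right power2_eq_square)
    finally have "\<forall>b\<in>B. c \<bullet> l b = 0"
      using \<open>finite B\<close> by (simp add: sum_nonneg_eq_0_iff)
    then have "orthogonal c c"
      using that(1) \<open>span (l ` B) = span D\<close>
      by (intro orthogonal_to_span[of c "l ` B"]) (auto simp: orthogonal_def)
    then show ?thesis
      by (simp add: orthogonal_def)
  qed
  ultimately obtain e where e: "e > 0" "\<And>c. c \<in> span D \<Longrightarrow> e * norm c \<le> norm (F c)"
    using injective_imp_isometric[of "span D" F] closed_span subspace_span by blast
  define s where "s = (\<Sum>b\<in>B. norm (l b)) + 1"
  have "s > 0"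
    unfolding s_def by (intro add_nonneg_pos sum_nonneg) auto
  have "\<exists>b\<in>insert 0 D. e / s * norm c \<le> \<bar>c \<bullet> l b\<bar>" if c: "c \<in> span D" for c
  proof (cases "c = 0")
    case False
    show ?thesis
    proof (rule ccontr)
      assume no: "\<not> ?thesis"
      have "norm (F c) \<le> (\<Sum>b\<in>B. norm ((c \<bullet> l b) *\<^sub>R l b))"
        unfolding F_def by (rule norm_sum)
      also have "\<dots> \<le> (\<Sum>b\<in>B. (e / s * norm c) * norm (l b))"
      proof (rule sum_mono)
        fix b assume "b \<in> B"
        then have "\<bar>c \<bullet> l b\<bar> \<le> e / s * norm c"
          using no B(1) by fastforce
        then show "norm ((c \<bullet> l b) *\<^sub>R l b) \<le> e / s * norm c * norm (l b)"
          unfolding norm_scaleR by (rule mult_right_mono) simp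
      qed
      also have "\<dots> = (e / s * norm c) * (s - 1)"
        by (simp add: s_def sum_distrib_left)
      also have "\<dots> < (e / s * norm c) * s"
        using False e(1) \<open>s > 0\<close> by (intro mult_strict_left_mono) auto
      also have "\<dots> = e * norm c"
        using \<open>s > 0\<close> by simp
      finally show False
        using e(2)[OF c] by simp
    qed
  qed auto
  then show ?thesis
    using e(1) \<open>s > 0\<close> by (intro exI[of _ "e / s"]) auto
qed

text \<open>Replacing \<open>c\<close> by its orthogonal projection avoids directions in which the attractor is flat.\<close>

lemma inner_span_representative:
  fixes D :: "'a::euclidean_space set"
  obtains y where "y \<in> span D" "\<And>v. v \<in> span D \<Longrightarrow> c \<bullet> v = y \<bullet> v"
proof -
  obtain y z where "y \<in> span D" "\<And>w. w \<in> span D \<Longrightarrow> orthogonal z w" "c = y + z"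
    using orthogonal_subspace_decomp_exists[of D c] by blast
  then show ?thesis
    by (intro that[of y]) (auto simp: inner_add_left orthogonal_def)
qed

context pencil
begin

text \<open>It is enough that one piece of the hull meets all the others in every direction. The hypothesis is one-sided, but
used with both \<open>c\<close> and \<open>- c\<close>: above the centre of the piece \<open>k\<close>, the intervals \<open>J\<^sub>k(t)\<close> and \<open>J\<^sub>i(t)\<close>
leave no gap up to the centre of the piece \<open>i\<close>, and similarly below.\<close>

lemma weakly_connected_if_meets:
  assumes t: "0 < t" "t < T" and k: "k \<in> {1..N}"
    and meet: "\<And>c l. l \<in> {1..N} \<Longrightarrow> \<exists>x\<in>K t. \<exists>y\<in>K t. c \<bullet> g t l x \<le> c \<bullet> g t k y"
  shows "weakly_connected (att t)"
proof (rule weakly_connected_if_covered_between[OF t])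
  fix c i j v
  assume ij: "i \<in> {1..N}" "j \<in> {1..N}" and v: "c \<bullet> q j < v" "v < c \<bullet> q i"
  have qK: "q i \<in> K t" "q j \<in> K t" "q k \<in> K t"
    using q_in_K[OF t] ij k by auto
  show "covered t c v"
  proof (cases "c \<bullet> q k \<le> v")
    case True
    obtain x y where xy: "x \<in> K t" "y \<in> K t" "c \<bullet> g t i x \<le> c \<bullet> g t k y"
      using meet[OF ij(1)] by blast
    show ?thesis
    proof (cases "v \<le> c \<bullet> g t k y")
      case True
      then show ?thesis
        using \<open>c \<bullet> q k \<le> v\<close> k qK xy by (intro covered_interval[OF t k, of "q k" y]) auto
    next
      case False
      then show ?thesis
        using v qK xy ij by (intro covered_interval[OF t ij(1), of x "q i"]) auto
    qed
  next
    case False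
    obtain x y where xy: "x \<in> K t" "y \<in> K t" "c \<bullet> g t k y \<le> c \<bullet> g t j x"
      using meet[OF ij(2), of "- c"] by auto
    show ?thesis
    proof (cases "c \<bullet> g t k y \<le> v")
      case True
      then show ?thesis
        using False k qK xy by (intro covered_interval[OF t k, of y "q k"]) auto
    next
      case False
      then show ?thesis
        using v qK xy ij by (intro covered_interval[OF t ij(2), of "q j" x]) auto
    qed
  qed
qed

lemma funpow_g:
  assumes k: "k \<in> {1..N}"
  shows "(g t k ^^ m) x - q k = t ^ m *\<^sub>R (L k ^^ m) (x - q k)"
proof (induction m)
  case (Suc m)
  have "(g t k ^^ Suc m) x - q k = t *\<^sub>R L k ((g t k ^^ m) x - q k)"
    by (simp add: g_def)
  also have "\<dots> = t *\<^sub>R L k (t ^ m *\<^sub>R (L k ^^ m) (x - q k))"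
    using Suc by simp
  finally show ?case
    by (simp add: linear_scale[OF linear_L[OF k]])
qed simp

text \<open>The attractor need not affinely span the whole space, so the lower bound for the widths of its pieces concerns
directions in the span of \<open>D\<close> only. The linear parts map this span into itself, because the
attractor is invariant.\<close>

lemma pieces_width_bound:
  assumes s: "0 < s" "s < T" and k: "k \<in> {1..N}"
    and inj: "\<And>l. l \<in> {1..N} \<Longrightarrow> inj (L l)"
  defines "D \<equiv> (\<lambda>x. x - q k) ` att s"
  shows "\<exists>d>0. \<forall>c\<in>span D. \<forall>l\<in>{1..N}. \<exists>x\<in>att s. \<exists>y\<in>att s.
    c \<bullet> g s l x + d * norm c \<le> c \<bullet> g s l y"
proof -
  have qk: "q k \<in> att s"
    by (rule q_in_att[OF s k])
  have D: "x - y \<in> span D" if "x \<in> att s" "y \<in> att s" for x y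
  proof -
    have "(x - q k) - (y - q k) \<in> span D"
      using that by (intro span_diff span_base) (auto simp: D_def)
    then show ?thesis by simp
  qed
  have "\<exists>d>0. \<forall>c\<in>span D. \<exists>b\<in>insert 0 D. d * norm c \<le> \<bar>c \<bullet> L l b\<bar>" if l: "l \<in> {1..N}" for l
  proof (rule spanning_image_inner_bound[OF linear_L[OF l] inj[OF l]])
    show "L l ` D \<subseteq> span D"
    proof clarify
      fix b assume "b \<in> D"
      then obtain x where x: "x \<in> att s" "b = x - q k"
        by (auto simp: D_def)
      have "g s l x - g s l (q k) \<in> span D"
        using x qk l by (intro D g_in_att[OF s])
      then have "s *\<^sub>R L l b \<in> span D"
        using x(2) by (simp add: g_diff[OF l])
      then have "(1 / s) *\<^sub>R (s *\<^sub>R L l b) \<in> span D"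
        by (rule span_scale)
      then show "L l b \<in> span D"
        using s by simp
    qed
  qed
  then obtain d where d: "\<And>l. l \<in> {1..N} \<Longrightarrow> d l > 0"
    "\<And>l c. l \<in> {1..N} \<Longrightarrow> c \<in> span D \<Longrightarrow> \<exists>b\<in>insert 0 D. d l * norm c \<le> \<bar>c \<bullet> L l b\<bar>"
    by metis
  define e where "e = s * (MIN l\<in>{1..N}. d l)"
  have "e > 0"
    using s k d(1) unfolding e_def by (intro mult_pos_pos) (auto simp: Min_gr_iff)
  moreover have "\<exists>x\<in>att s. \<exists>y\<in>att s. c \<bullet> g s l x + e * norm c \<le> c \<bullet> g s l y"
    if c: "c \<in> span D" and l: "l \<in> {1..N}" for c l
  proof -
    have "0 \<in> D"
      using qk by (force simp: D_def)
    then obtain b where "b \<in> D" and b: "d l * norm c \<le> \<bar>c \<bullet> L l b\<bar>"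
      using d(2)[OF l c] by auto
    then obtain x where x: "x \<in> att s" "b = x - q k"
      by (auto simp: D_def)
    have "e * norm c \<le> s * (d l * norm c)"
      using l s unfolding e_def by (auto simp: mult.assoc intro!: mult_left_mono mult_right_mono Min_le)
    also have "\<dots> \<le> s * \<bar>c \<bullet> L l b\<bar>"
      using b s by simp
    also have "\<dots> = \<bar>c \<bullet> (g s l x - g s l (q k))\<bar>"
      using s by (simp add: g_diff[OF l] x(2) abs_mult)
    finally have "e * norm c \<le> \<bar>c \<bullet> g s l x - c \<bullet> g s l (q k)\<bar>"
      by (simp add: inner_diff_right)
    then consider "c \<bullet> g s l (q k) + e * norm c \<le> c \<bullet> g s l x"
      | "c \<bullet> g s l x + e * norm c \<le> c \<bullet> g s l (q k)"
      by linarith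
    then show ?thesis
      using x(1) qk by cases blast+
  qed
  ultimately show ?thesis by blast
qed

text \<open>The parameter is \<open>t = u / r\<close> with \<open>u < 1\<close> close to \<open>1\<close>, compared with the fixed parameter \<open>s = 1 / (2 r)\<close>. Given a
direction \<open>c\<close> and a piece \<open>l\<close>, the piece at \<open>s\<close> contains points \<open>g s l a\<close> and \<open>x\<close> whose values under \<open>c\<close> differ by at
least \<open>d * norm y\<close>, where \<open>y\<close> represents \<open>c\<close> on the span of \<open>D\<close>. The point \<open>z = (g t k ^^ m) x\<close> lies in the piece \<open>k\<close> at \<open>t\<close>, and recurrence places it within \<open>d\<close> of
\<open>x\<close>. So its value is still at least that of \<open>g s l a\<close>, and the pieces meet in direction \<open>c\<close>.\<close>

theorem weakly_connected_similarities:
  assumes r: "0 < r" "1 / r \<le> T" and k: "k \<in> {1..N}"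
    and sim: "\<And>x. norm (L k x) = r * norm x"
    and inj: "\<And>l. l \<in> {1..N} \<Longrightarrow> inj (L l)"
  shows "\<exists>t. 0 < t \<and> t < T \<and> weakly_connected (att t)"
proof -
  define s where "s = 1 / (2 * r)"
  have "s < 1 / r"
    using r(1) by (simp add: s_def field_simps)
  then have s: "0 < s" "s < T"
    using r by (auto simp: s_def)
  have qk: "q k \<in> att s"
    by (rule q_in_att[OF s k])
  define D where "D = (\<lambda>x. x - q k) ` att s"
  obtain d where "d > 0" and d: "\<And>c l. c \<in> span D \<Longrightarrow> l \<in> {1..N} \<Longrightarrow>
      \<exists>x\<in>att s. \<exists>y\<in>att s. c \<bullet> g s l x + d * norm c \<le> c \<bullet> g s l y"
    using pieces_width_bound[OF s k inj] unfolding D_def by metis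
  have "bounded D"
    unfolding D_def
    by (intro compact_imp_bounded compact_continuous_image compact_att[OF s] continuous_intros)
  then obtain R where R: "R > 0" "\<And>v. v \<in> D \<Longrightarrow> norm v \<le> R"
    by (auto simp: bounded_pos)
  define E where "E x = (1 / r) *\<^sub>R L k x" for x
  have E: "linear E" "\<And>x. norm (E x) = norm x"
    using r(1) sim linear_L[OF k] unfolding E_def by (auto intro!: linear_compose_scale_right)
  \<comment> \<open>The recurrence error and the error from \<open>u < 1\<close> both scale with the norm, at most \<open>R\<close>; together they give \<open>d\<close>.\<close>
  define e where "e = d / (2 * R)"
  have "e > 0"
    using \<open>d > 0\<close> R by (simp add: e_def)
  obtain m where m: "m \<ge> 1" "\<And>x. norm ((E ^^ m) x - x) \<le> e * norm x"
    using linear_isometry_recurrent[OF E \<open>e > 0\<close>] by blast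
  have LE: "(L k ^^ n) x = r ^ n *\<^sub>R (E ^^ n) x" for n x
  proof (induction n)
    case (Suc n)
    then show ?case
      using r(1) by (simp add: E_def linear_scale[OF linear_L[OF k]])
  qed simp
  have "((\<lambda>u. u ^ m) \<longlongrightarrow> 1 ^ m) (at_left (1::real))"
    by (intro tendsto_intros)
  then have "\<forall>\<^sub>F u in at_left (1::real). dist (u ^ m) 1 < e"
    using \<open>e > 0\<close> by (simp add: tendstoD)
  moreover have "\<forall>\<^sub>F u in at_left (1::real). u \<in> {1/2<..<1}"
    by (rule eventually_at_left_real) simp
  ultimately have "\<forall>\<^sub>F u in at_left (1::real). dist (u ^ m) 1 < e \<and> 1/2 < u \<and> u < 1"
    by eventually_elim auto
  then obtain u :: real where u: "dist (u ^ m) 1 < e" "1/2 < u" "u < 1"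
    using eventually_happens'[OF trivial_limit_at_left_real] by blast
  define t where "t = u / r"
  have "t < 1 / r" "s \<le> t"
    using u r(1) by (auto simp: t_def s_def field_simps)
  then have t: "0 < t" "t < T"
    using r s by auto
  have sub: "att s \<subseteq> K t"
    using K_mono[OF s(1) \<open>s \<le> t\<close> t(2)] hull_subset[of "att s" convex] by blast
  have "weakly_connected (att t)"
  proof (rule weakly_connected_if_meets[OF t k])
    fix c l assume l: "l \<in> {1..N}"
    obtain y where y: "y \<in> span D" "\<And>v. v \<in> span D \<Longrightarrow> c \<bullet> v = y \<bullet> v"
      using inner_span_representative by blast
    obtain a b where ab: "a \<in> att s" "b \<in> att s" "y \<bullet> g s l a + d * norm y \<le> y \<bullet> g s l b"
      using d[OF y(1) l] by blast
    define x where "x = g s l b"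
    have x: "x \<in> att s"
      unfolding x_def by (rule g_in_att[OF s l ab(2)])
    define z where "z = (g t k ^^ m) x"
    have funpow_K: "(g t k ^^ n) x \<in> K t" for n
      using x sub by (induction n) (auto intro!: g_in_K[OF t k])
    have z_eq: "z = g t k ((g t k ^^ (m - 1)) x)"
      using m(1) unfolding z_def by (cases m) auto
    define v where "v = x - q k"
    have v: "v \<in> D" "norm v \<le> R"
      using x R(2) by (auto simp: v_def D_def)
    have zv: "z - q k = u ^ m *\<^sub>R (E ^^ m) v"
      using r(1) unfolding z_def funpow_g[OF k] LE v_def
      by (simp add: t_def power_divide)
    have "E w \<in> span D" if "w \<in> span D" for w
    proof -
      have "E ` D \<subseteq> span D"
      proof clarify
        fix w assume "w \<in> D"
        then obtain p where p: "p \<in> att s" "w = p - q k"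
          by (auto simp: D_def)
        have "g s k p - q k \<in> span D"
          using g_in_att[OF s k p(1)] by (intro span_base) (auto simp: D_def)
        then have "(1 / (s * r)) *\<^sub>R (g s k p - q k) \<in> span D"
          by (rule span_scale)
        then show "E w \<in> span D"
          using s by (simp add: g_def E_def p(2))
      qed
      then have "span (E ` D) \<subseteq> span D"
        by (intro span_minimal) auto
      then show ?thesis
        using that by (auto simp: linear_span_image[OF E(1)])
    qed
    then have Em: "(E ^^ n) v \<in> span D" for n
      using v(1) by (induction n) (auto intro: span_base)
    have "norm (u ^ m *\<^sub>R (E ^^ m) v - v)
        = norm ((u ^ m - 1) *\<^sub>R (E ^^ m) v + ((E ^^ m) v - v))"
      by (simp add: algebra_simps)
    also have "\<dots> \<le> \<bar>u ^ m - 1\<bar> * norm ((E ^^ m) v) + norm ((E ^^ m) v - v)"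
      by (rule norm_triangle_mono) auto
    also have "\<dots> \<le> e * norm v + e * norm v"
      using u(1) m(2)[of v] by (intro add_mono mult_mono)
        (auto simp: funpow_norm[OF E(2)] dist_real_def)
    also have "\<dots> \<le> 2 * e * R"
      using v(2) \<open>e > 0\<close> by simp
    also have "\<dots> = d"
      using R(1) by (simp add: e_def)
    finally have close: "norm ((z - q k) - v) \<le> d"
      by (simp add: zv)
    have "\<bar>y \<bullet> ((z - q k) - v)\<bar> \<le> norm y * d"
      using Cauchy_Schwarz_ineq2[of y "(z - q k) - v"] close
      by (meson mult_left_mono norm_ge_zero order_trans)
    then have "y \<bullet> v - norm y * d \<le> y \<bullet> (z - q k)"
      by (simp add: inner_diff_right)
    moreover have "y \<bullet> (g s l a - q k) + norm y * d \<le> y \<bullet> v"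
      using ab(3) by (simp add: v_def x_def inner_diff_right mult.commute)
    ultimately have "y \<bullet> (g s l a - q k) \<le> y \<bullet> (z - q k)"
      by linarith
    moreover have "g s l a - q k \<in> span D"
      using g_in_att[OF s l ab(1)] by (intro span_base) (auto simp: D_def)
    moreover have "z - q k \<in> span D"
      unfolding zv by (intro span_scale Em)
    ultimately have "c \<bullet> (g s l a - q k) \<le> c \<bullet> (z - q k)"
      using y(2) by metis
    then have "c \<bullet> g s l a \<le> c \<bullet> z"
      by (simp add: inner_diff_right)
    moreover obtain a' where "a' \<in> K t" "g t l a' = g s l a"
      using g_K_mono[OF s(1) \<open>s \<le> t\<close> t(2) l] hull_inc[OF ab(1)] by blast
    ultimately show "\<exists>x\<in>K t. \<exists>y\<in>K t. c \<bullet> g t l x \<le> c \<bullet> g t k y"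
      using funpow_K[of "m - 1"] z_eq by metis
  qed
  then show ?thesis
    using t by blast
qed

end

section \<open>The joint spectral radius\<close>

lemma linear_part_eq:
  fixes f :: "real^'n \<Rightarrow> real^'n"
  assumes f: "\<And>x. f x = M *v x + a"
  shows "linear_part f = M"
  unfolding linear_part_def
proof (rule the_equality)
  show "\<exists>a. \<forall>x. f x = M *v x + a"
    using f by blast
  fix M' assume "\<exists>a. \<forall>x. f x = M' *v x + a"
  then obtain a' where a': "\<And>x. f x = M' *v x + a'"
    by blast
  have "a' = a"
    using f[of 0] a'[of 0] by simp
  then have "M' *v x = M *v x" for x
    using f[of x] a'[of x] by simp
  then show "M' = M"
    by (simp add: matrix_eq)
qed

lemma word_matrix_mult: "word_matrix M w *v x = word_map (\<lambda>i. (*v) (M i)) w x"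
  by (induction w) (simp_all add: word_matrix_def flip: matrix_vector_mul_assoc)

lemma word_map_norm_le:
  assumes "0 \<le> B" "\<And>i x. i \<in> {1..N} \<Longrightarrow> norm (g i x) \<le> B * norm x" "w \<in> words N k"
  shows "norm (word_map g w x) \<le> B ^ k * norm x"
  using assms(3)
proof (induction k arbitrary: w)
  case (Suc k)
  then obtain i v where v: "v \<in> words N k" "i \<in> {1..N}" "w = i # v"
    unfolding words_Suc by blast
  have "norm (word_map g w x) \<le> B * norm (word_map g v x)"
    using v assms(2) by simp
  also have "\<dots> \<le> B * (B ^ k * norm x)"
    using Suc.IH[OF v(1)] assms(1) by (rule mult_left_mono)
  finally show ?case by simp
qed (simp add: words_0)

lemma replicate_word_map_norm_ge:
  assumes "0 \<le> m" "\<And>x. m * norm x \<le> norm (g i x)"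
  shows "m ^ k * norm x \<le> norm (word_map g (replicate k i) x)"
proof (induction k)
  case (Suc k)
  have "m ^ Suc k * norm x \<le> m * norm (word_map g (replicate k i) x)"
    using Suc assms(1) by (simp add: mult.assoc mult_left_mono)
  also have "\<dots> \<le> norm (g i (word_map g (replicate k i) x))"
    by (rule assms(2))
  finally show ?case by simp
qed simp

text \<open>The quantity whose \<open>k\<close>-th root defines the joint spectral radius.\<close>

definition max_norm :: "nat \<Rightarrow> (nat \<Rightarrow> real^'n \<Rightarrow> real^'n) \<Rightarrow> nat \<Rightarrow> real" where
  "max_norm N f k = (MAX w\<in>words N k. onorm ((*v) (word_matrix (\<lambda>i. linear_part (f i)) w)))"

context
  fixes N :: nat and f :: "nat \<Rightarrow> real^'n \<Rightarrow> real^'n"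
  assumes N: "1 \<le> N" and inv: "\<And>i. i \<in> {1..N} \<Longrightarrow> invertible (linear_part (f i))"
begin

lemma norm_word_le_max_norm:
  assumes "w \<in> words N k"
  shows "norm (word_map (\<lambda>i. (*v) (linear_part (f i))) w x) \<le> max_norm N f k * norm x"
proof -
  let ?A = "word_matrix (\<lambda>i. linear_part (f i)) w"
  have "norm (?A *v x) \<le> onorm ((*v) ?A) * norm x"
    by (rule onorm) simp
  also have "onorm ((*v) ?A) \<le> max_norm N f k"
    unfolding max_norm_def using assms finite_words by (intro Max_ge) auto
  finally show ?thesis
    by (simp add: word_matrix_mult mult_right_mono)
qed

lemma max_norm_le:
  assumes "0 \<le> B" "\<And>i x. i \<in> {1..N} \<Longrightarrow> norm (linear_part (f i) *v x) \<le> B * norm x"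
  shows "max_norm N f k \<le> B ^ k"
  unfolding max_norm_def
proof (rule Max.boundedI)
  fix y assume "y \<in> (\<lambda>w. onorm ((*v) (word_matrix (\<lambda>i. linear_part (f i)) w))) ` words N k"
  then obtain w where w: "w \<in> words N k" "y = onorm ((*v) (word_matrix (\<lambda>i. linear_part (f i)) w))"
    by blast
  have "norm (word_map (\<lambda>i. (*v) (linear_part (f i))) w x) \<le> B ^ k * norm x" for x
    by (rule word_map_norm_le[OF assms(1) _ w(1)]) (rule assms(2))
  then show "y \<le> B ^ k"
    unfolding w(2) by (intro onorm_le) (simp add: word_matrix_mult)
qed (use finite_words words_nonempty[OF N] in auto)

lemma limsup_root_max_norm_le:
  assumes "0 \<le> B" "\<And>i x. i \<in> {1..N} \<Longrightarrow> norm (linear_part (f i) *v x) \<le> B * norm x"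
  shows "limsup (\<lambda>k. ereal (root k (max_norm N f k))) \<le> ereal B"
proof (rule Limsup_bounded)
  show "\<forall>\<^sub>F k in sequentially. ereal (root k (max_norm N f k)) \<le> ereal B"
    using eventually_gt_at_top[of 0]
  proof eventually_elim
    case (elim k)
    then show ?case
      using real_root_le_mono[OF elim max_norm_le[OF assms, of k]] assms(1)
      by (simp add: real_root_power_cancel)
  qed
qed

lemma max_norm_ge: "\<exists>m>0. \<forall>k. m ^ k \<le> max_norm N f k"
proof -
  have "1 \<in> {1..N}"
    using N by simp
  then have "inj ((*v) (linear_part (f 1)))"
    using inv inj_matrix_vector_mult by blast
  then obtain m where m: "m > 0" "\<And>x. m * norm x \<le> norm (linear_part (f 1) *v x)"
    using linear_inj_bounded_below_pos matrix_vector_mul_linear by metis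
  have "m ^ k \<le> max_norm N f k" for k
  proof -
    obtain x :: "real^'n" where x: "norm x = 1"
      using vector_choose_size[of 1] by auto
    have "m ^ k * norm x \<le> norm (word_map (\<lambda>i. (*v) (linear_part (f i))) (replicate k 1) x)"
      by (rule replicate_word_map_norm_ge) (use m in auto)
    also have "\<dots> \<le> max_norm N f k * norm x"
      by (rule norm_word_le_max_norm) (use N in \<open>auto simp: words_def\<close>)
    finally show ?thesis
      by (simp add: x)
  qed
  then show ?thesis
    using m(1) by blast
qed

text \<open>The roots lie between a lower bound of one linear part, positive by invertibility, and the sum of
the operator norms, so the limit superior is finite and positive.\<close>

lemma
  shows ereal_joint_spectral_radius: "ereal (joint_spectral_radius N f) =
      limsup (\<lambda>k. ereal (root k (max_norm N f k)))"
    and joint_spectral_radius_pos: "0 < joint_spectral_radius N f"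
proof -
  let ?l = "limsup (\<lambda>k. ereal (root k (max_norm N f k)))"
  have jsr: "joint_spectral_radius N f = real_of_ereal ?l"
    unfolding joint_spectral_radius_def max_norm_def words_def by (rule refl)
  obtain m where m: "m > 0" "\<And>k. m ^ k \<le> max_norm N f k"
    using max_norm_ge by blast
  define B where "B = (\<Sum>i\<in>{1..N}. onorm ((*v) (linear_part (f i))))"
  have "0 \<le> B"
    unfolding B_def by (intro sum_nonneg onorm_pos_le) simp
  have B: "norm (linear_part (f i) *v x) \<le> B * norm x" if "i \<in> {1..N}" for i x
  proof -
    have "norm (linear_part (f i) *v x) \<le> onorm ((*v) (linear_part (f i))) * norm x"
      by (rule onorm) simp
    also have "onorm ((*v) (linear_part (f i))) \<le> B"
      unfolding B_def by (rule member_le_sum) (use that in \<open>auto intro: onorm_pos_le\<close>)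
    finally show ?thesis
      by (simp add: mult_right_mono)
  qed
  have ev: "\<forall>\<^sub>F k::nat in sequentially. 0 < k"
    by (rule eventually_gt_at_top)
  have "ereal m \<le> ?l"
  proof (rule le_Limsup[OF sequentially_bot])
    show "\<forall>\<^sub>F k in sequentially. ereal m \<le> ereal (root k (max_norm N f k))"
      using ev
    proof eventually_elim
      case (elim k)
      then show ?case
        using real_root_le_mono[OF elim m(2)[of k]] m(1) by (simp add: real_root_power_cancel)
    qed
  qed
  moreover have "?l \<le> ereal B"
    using \<open>0 \<le> B\<close> B by (rule limsup_root_max_norm_le)
  ultimately have "\<bar>?l\<bar> \<noteq> \<infinity>"
    by auto
  then show eq: "ereal (joint_spectral_radius N f) = ?l"
    by (simp add: jsr ereal_real')
  have "ereal m \<le> ereal (joint_spectral_radius N f)"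
    unfolding eq by fact
  then show "0 < joint_spectral_radius N f"
    using m(1) by simp
qed

lemma joint_spectral_radius_le:
  assumes "0 \<le> B" "\<And>i x. i \<in> {1..N} \<Longrightarrow> norm (linear_part (f i) *v x) \<le> B * norm x"
  shows "joint_spectral_radius N f \<le> B"
  using limsup_root_max_norm_le[OF assms] by (simp flip: ereal_joint_spectral_radius)

text \<open>With \<open>r\<close> strictly between the joint spectral radius and \<open>1 / t\<close>, the norm of long words is at most
\<open>r ^ n\<close>, and \<open>(t * r) ^ n\<close> tends to zero.\<close>

lemma words_contract_below_t0:
  assumes t: "0 < t" "t < t0 N f" and "0 < e"
  shows "\<forall>\<^sub>F n in sequentially. \<forall>w\<in>words N n. \<forall>x.
    t ^ n * norm (word_map (\<lambda>i. (*v) (linear_part (f i))) w x) \<le> e * norm x"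
proof -
  have "joint_spectral_radius N f < 1 / t"
    using t joint_spectral_radius_pos by (simp add: t0_def field_simps)
  then obtain r where r: "joint_spectral_radius N f < r" "r < 1 / t"
    using dense by blast
  then have "0 < r" "t * r < 1"
    using t joint_spectral_radius_pos by (auto simp: field_simps)
  have "limsup (\<lambda>k. ereal (root k (max_norm N f k))) < ereal r"
    using r(1) by (simp flip: ereal_joint_spectral_radius)
  then have "\<forall>\<^sub>F n in sequentially. ereal (root n (max_norm N f n)) < ereal r"
    by (rule Limsup_lessD)
  moreover have "(\<lambda>n. (t * r) ^ n) \<longlonglongrightarrow> 0"
    using t \<open>0 < r\<close> \<open>t * r < 1\<close> by (intro LIMSEQ_realpow_zero) auto
  then have "\<forall>\<^sub>F n in sequentially. (t * r) ^ n < e"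
    using \<open>0 < e\<close> by (rule order_tendstoD)
  moreover have "\<forall>\<^sub>F n::nat in sequentially. 0 < n"
    by (rule eventually_gt_at_top)
  ultimately show ?thesis
  proof eventually_elim
    case (elim n)
    obtain m where "m > 0" "\<And>k. m ^ k \<le> max_norm N f k"
      using max_norm_ge by blast
    then have "0 \<le> max_norm N f n"
      by (meson less_imp_le order_trans zero_le_power)
    then have "max_norm N f n = root n (max_norm N f n) ^ n"
      using elim by (simp add: real_root_pow_pos2)
    also have "\<dots> \<le> r ^ n"
      using elim \<open>0 \<le> max_norm N f n\<close> by (intro power_mono) auto
    finally have "t ^ n * max_norm N f n \<le> t ^ n * r ^ n"
      using t by (intro mult_left_mono) auto
    then have le: "t ^ n * max_norm N f n \<le> e"
      using elim by (simp add: power_mult_distrib)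
    show ?case
    proof (intro ballI allI)
      fix w x assume "w \<in> words N n"
      then have "t ^ n * norm (word_map (\<lambda>i. (*v) (linear_part (f i))) w x)
          \<le> t ^ n * (max_norm N f n * norm x)"
        using t by (intro mult_left_mono norm_word_le_max_norm) auto
      also have "\<dots> \<le> e * norm x"
        using le mult_right_mono[of "t ^ n * max_norm N f n" e "norm x"] by (simp add: mult.assoc)
      finally show "t ^ n * norm (word_map (\<lambda>i. (*v) (linear_part (f i))) w x) \<le> e * norm x" .
    qed
  qed
qed

end

section \<open>Semi-linear families\<close>

text \<open>A linear map fixes \<open>0\<close>, so \<open>h 0\<close> is a fixed point for every parameter. At \<open>t = 0\<close> the map is constant with
value \<open>q i\<close>, hence \<open>h 0 = q i\<close>, and any positive parameter then gives the claim.\<close>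

lemma semilinear_fixed_center:
  assumes "semilinear_family N f q" "i \<in> {1..N}" "0 < t0 N f"
  shows "f i (q i) = 0"
proof -
  obtain h where h: "\<And>t. t \<in> {0..<t0 N f} \<Longrightarrow>
      \<exists>g. linear g \<and> conjugate_by h (family_fun f q i t) g"
    using assms(1,2) unfolding semilinear_family_def by blast
  have fixed: "family_fun f q i t (h 0) = h 0" if t: "t \<in> {0..<t0 N f}" for t
  proof -
    obtain g where g: "linear g" "bij h" "g = inv h \<circ> family_fun f q i t \<circ> h"
      using h[OF t] unfolding conjugate_by_def by blast
    have "inv h (family_fun f q i t (h 0)) = 0"
      using linear_0[OF g(1)] g(3) by simp
    then show ?thesis
      using g(2) by (metis bij_inv_eq_iff)
  qed
  have "h 0 = q i"
    using fixed[of 0] assms(3) by (simp add: family_fun_def)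
  then show ?thesis
    using fixed[of "t0 N f / 2"] assms(3) by (simp add: family_fun_def)
qed

theorem theorem6p4:
  fixes N :: nat and f :: "nat \<Rightarrow> real^'n \<Rightarrow> real^'n" and q :: "nat \<Rightarrow> real^'n"
  assumes "affine_family N f"
    and "semilinear_family N f q"
    and "\<not> linear_family N f q"
  shows "\<exists>\<tau>. 0 < \<tau> \<and> \<tau> \<le> t0 N f
    \<and> (\<forall>t. \<tau> < t \<and> t < t0 N f \<longrightarrow> weakly_connected (attractor N f q t))
    \<and> (\<forall>t. 0 < t \<and> t < \<tau> \<longrightarrow> strongly_disconnected (attractor N f q t))
    \<and> ((\<forall>i\<in>{1..N}. \<forall>t. 0 < t \<and> t < t0 N f \<longrightarrow> is_similarity (family_fun f q i t))
        \<longrightarrow> \<tau> < t0 N f)"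
proof -
  define M where "M i = linear_part (f i)" for i
  have N: "1 \<le> N"
    using assms(1) by (simp add: affine_family_def)
  have affine: "\<exists>a. invertible (M i) \<and> (\<forall>x. f i x = M i *v x + a)" if "i \<in> {1..N}" for i
  proof -
    have "affine_function (f i)"
      using assms(1) that by (simp add: affine_family_def)
    then obtain A a where "invertible A" and A: "\<forall>x. f i x = A *v x + a"
      unfolding affine_function_def by blast
    moreover have "M i = A"
      unfolding M_def using A by (intro linear_part_eq[of _ A a]) simp
    ultimately show ?thesis
      by (intro exI[of _ a]) simp
  qed
  have inv: "invertible (linear_part (f i))" if "i \<in> {1..N}" for i
    using affine[OF that] by (simp add: M_def)
  have t0_pos: "0 < t0 N f"
    using joint_spectral_radius_pos[OF N inv] by (simp add: t0_def)
  have f_eq: "f i x = M i *v (x - q i)" if i: "i \<in> {1..N}" for i x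
  proof -
    obtain a where a: "\<And>x. f i x = M i *v x + a"
      using affine[OF i] by blast
    have "f i x = f i x - f i (q i)"
      using semilinear_fixed_center[OF assms(2) i t0_pos] by simp
    then show ?thesis
      by (simp add: a matrix_vector_mult_diff_distrib)
  qed
  interpret pencil N "\<lambda>i. (*v) (M i)" q "t0 N f"
  proof (rule pencil.intro)
    show "\<forall>\<^sub>F n in sequentially. \<forall>w\<in>words N n. \<forall>x.
        t ^ n * norm (word_map (\<lambda>i. (*v) (M i)) w x) \<le> e * norm x"
      if "0 < t" "t < t0 N f" "0 < e" for t e
      unfolding M_def by (rule words_contract_below_t0[OF N inv that])
  qed (rule N matrix_vector_mul_linear)+
  have family: "family_fun f q i t = g t i" if "i \<in> {1..N}" for i t
    by (simp add: family_fun_def g_def f_eq[OF that] fun_eq_iff)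
  have attractor: "attractor N f q t = att t" if "0 < t" "t < t0 N f" for t
  proof -
    have "hutchinson N (\<lambda>i. family_fun f q i t) = hutchinson N (g t)"
      by (rule hutchinson_cong) (rule family)
    then show ?thesis
      using the_attractor_att[OF that] by (simp add: attractor_def is_attractor_def)
  qed
  \<comment> \<open>If all centres agree, the translation by the common centre makes the family linear.\<close>
  have "\<exists>i\<in>{1..N}. \<exists>j\<in>{1..N}. q i \<noteq> q j"
  proof (rule ccontr)
    assume same: "\<not> ?thesis"
    have "1 \<in> {1..N}"
      using N by simp
    then have q: "q i = q 1" if "i \<in> {1..N}" for i
      using same that by blast
    define h where "h x = x + q 1" for x
    have "bij h"
      unfolding h_def by (rule bij_betw_byWitness[where f' = "\<lambda>y. y - q 1"]) auto
    have "inv h y = y - q 1" for y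
      by (rule inv_f_eq[OF bij_is_inj[OF \<open>bij h\<close>]]) (simp add: h_def)
    then have "inv h \<circ> family_fun f q i t \<circ> h = (\<lambda>x. t *\<^sub>R (M i *v x))" if "i \<in> {1..N}" for i t
      using q[OF that] by (simp add: family[OF that] g_def h_def fun_eq_iff)
    then have "linear_family N f q"
      unfolding linear_family_def conjugate_by_def
      using \<open>bij h\<close> by (auto intro!: exI[of _ h] linear_compose_scale_right)
    then show False
      using assms(3) by contradiction
  qed
  then obtain i j where "i \<in> {1..N}" "j \<in> {1..N}" "q i \<noteq> q j"
    by blast
  from weakly_connected_threshold[OF t0_pos this] obtain \<tau> where \<tau>: "0 < \<tau>" "\<tau> \<le> t0 N f"
    "\<And>t. \<tau> < t \<Longrightarrow> t < t0 N f \<Longrightarrow> weakly_connected (att t)"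
    "\<And>t. 0 < t \<Longrightarrow> t < \<tau> \<Longrightarrow> strongly_disconnected (att t)"
    "\<And>t. 0 < t \<Longrightarrow> t < t0 N f \<Longrightarrow> weakly_connected (att t) \<Longrightarrow> \<tau> \<le> t"
    by blast
  have "\<tau> < t0 N f"
    if sim: "\<forall>i\<in>{1..N}. \<forall>t. 0 < t \<and> t < t0 N f \<longrightarrow> is_similarity (family_fun f q i t)"
  proof -
    define s where "s = t0 N f / 2"
    have s: "0 < s" "s < t0 N f"
      using t0_pos by (auto simp: s_def)
    have "\<exists>r>0. \<forall>x. norm (M i *v x) = r * norm x" if i: "i \<in> {1..N}" for i
    proof -
      obtain r where r: "r > 0" "\<And>x y. dist (g s i x) (g s i y) = r * dist x y"
        using sim i s family[OF i] unfolding is_similarity_def by metis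
      have "norm (M i *v x) = (r / s) * norm x" for x
        using r(2)[of x 0] s g_diff[OF i, of s x 0] by (simp add: dist_norm field_simps)
      then show ?thesis
        using r(1) s by (intro exI[of _ "r / s"]) auto
    qed
    then obtain r where r: "\<And>i. i \<in> {1..N} \<Longrightarrow> 0 < r i"
      "\<And>i x. i \<in> {1..N} \<Longrightarrow> norm (M i *v x) = r i * norm x"
      by metis
    have "Max (r ` {1..N}) \<in> r ` {1..N}"
      using N by (intro Max_in) auto
    then obtain k where k: "k \<in> {1..N}" "r k = Max (r ` {1..N})"
      by auto
    have "r i \<le> r k" if "i \<in> {1..N}" for i
      unfolding k(2) using that by simp
    then have "joint_spectral_radius N f \<le> r k"
      using r k(1) by (intro joint_spectral_radius_le[OF N inv])
        (auto simp: M_def less_imp_le mult_right_mono)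
    then have "1 / r k \<le> t0 N f"
      using joint_spectral_radius_pos[OF N inv] by (simp add: t0_def frac_le)
    moreover have "inj ((*v) (M l))" if "l \<in> {1..N}" for l
      using affine[OF that] inj_matrix_vector_mult by blast
    ultimately obtain t where "0 < t" "t < t0 N f" "weakly_connected (att t)"
      using weakly_connected_similarities[OF r(1)[OF k(1)] _ k(1) r(2)[OF k(1)]] by blast
    then show ?thesis
      using \<tau>(5)[of t] by simp
  qed
  then show ?thesis
    using \<tau> attractor by (intro exI[of _ \<tau>]) auto
qed

end
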